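(* Let $n\ge3$ and let $k$ be an integer with $1<k<n/2$. If $q>\frac{(n+2)k}{n-2k}$, then the equation $$F_k(D^2u)=(-u)^q,\qquad u<0\text{ in }\mathbb{R}^n,$$ has radial solutions with the slow decay rate $\frac{2k}{q-k}$.
   Context: $F_k(D^2u)=S_k(\lambda(D^2u))$ is the $k$-Hessian operator, where $\lambda(D^2u)=(\lambda_1,\dots,\lambda_n)$ are the eigenvalues of the Hessian matrix $D^2u$ and $S_k(\lambda)=\sum_{1\le i_1<\cdots<i_k\le n}\lambda_{i_1}\cdots\lambda_{i_k}$. A solution $u$ has decay rate $\gamma>0$ if $-u(x)$ is bounded above and below by positive constant multiples of $|x|^{-\gamma}$ for large $|x|$. *)

theory Defs
  imports "HOL-Analysis.Analysis" "HOL-Computational_Algebra.Polynomial" "HOL-Library.Multiset"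
begin

definition partial_deriv :: "'n::finite \<Rightarrow> (real^'n \<Rightarrow> real) \<Rightarrow> real^'n \<Rightarrow> real" where
  "partial_deriv i f x = frechet_derivative f (at x) (axis i 1)"

text \<open>Twice continuously differentiable on the whole space. As \<open>frechet_derivative\<close> is
  total, the differentiability conditions are needed to make the partial derivatives meaningful;
  continuity of \<open>f\<close> and of its first partial derivatives follows from them.\<close>
definition C2 :: "(real^'n::finite \<Rightarrow> real) \<Rightarrow> bool" where
  "C2 f \<longleftrightarrow> (\<forall>x. f differentiable (at x)) \<and>
     (\<forall>i x. partial_deriv i f differentiable (at x)) \<and>
     (\<forall>i j. continuous_on UNIV (partial_deriv i (partial_deriv j f)))"

definition hessian :: "(real^'n::finite \<Rightarrow> real) \<Rightarrow> real^'n \<Rightarrow> real^'n^'n" where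
  "hessian f x = (\<chi> i j. partial_deriv i (partial_deriv j f) x)"

definition charpoly :: "real^'n::finite^'n \<Rightarrow> real poly" where
  "charpoly A = det (\<chi> i j. (if i = j then [:0, 1:] else 0) - [:A $ i $ j:])"

text \<open>The real eigenvalues in increasing order, repeated according to algebraic multiplicity.
  For a symmetric matrix (such as the Hessian of a \<open>C2\<close> function) the list has
  length \<open>CARD('n)\<close>.\<close>
definition eigenvals :: "real^'n::finite^'n \<Rightarrow> real list" where
  "eigenvals A = sorted_list_of_multiset (proots (charpoly A))"

text \<open>A choice of indices \<open>i\<^sub>1 < \<dots> < i\<^sub>k\<close> is encoded as the \<open>k\<close>-element set of these indices.\<close>
definition elem_sym :: "nat \<Rightarrow> real list \<Rightarrow> real" where
  "elem_sym k xs = (\<Sum>I | I \<subseteq> {..<length xs} \<and> card I = k. \<Prod>i\<in>I. xs ! i)"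

definition k_Hessian_op :: "nat \<Rightarrow> real^'n::finite^'n \<Rightarrow> real" where
  "k_Hessian_op k A = elem_sym k (eigenvals A)"

definition radial :: "(real^'n::finite \<Rightarrow> real) \<Rightarrow> bool" where
  "radial u \<longleftrightarrow> (\<exists>f. \<forall>x. u x = f (norm x))"

definition has_decay_rate :: "(real^'n::finite \<Rightarrow> real) \<Rightarrow> real \<Rightarrow> bool" where
  "has_decay_rate u \<gamma> \<longleftrightarrow> \<gamma> > 0 \<and>
     (\<exists>c>0. \<exists>C>0. \<forall>\<^sub>F x in at_infinity.
        c * norm x powr (-\<gamma>) \<le> - u x \<and> - u x \<le> C * norm x powr (-\<gamma>))"

text \<open>Classical solutions of \<open>F\<^sub>k(D\<^sup>2u) = (-u)\<^sup>q\<close>, \<open>u < 0\<close>, on the whole space.\<close>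
definition k_Hessian_solution :: "nat \<Rightarrow> real \<Rightarrow> (real^'n::finite \<Rightarrow> real) \<Rightarrow> bool" where
  "k_Hessian_solution k q u \<longleftrightarrow> C2 u \<and> (\<forall>x. u x < 0) \<and>
     (\<forall>x. k_Hessian_op k (hessian u x) = (- u x) powr q)"

end

theory Submission
  imports Defs
begin

text \<open>For \<open>u(x) = - v(|x|)\<close> the Hessian is a multiple of the identity plus a rank-one matrix, so the
  equation becomes an ordinary differential equation for \<open>v\<close>, which is solved with \<open>v(0) = 1\<close> and
  truncated nonlinearity by Picard iteration. Put \<open>\<gamma> = 2k/(q - k)\<close>, \<open>z = r\<^sup>\<gamma> v\<close>, \<open>y = - r\<^sup>\<gamma>\<^sup>+\<^sup>1 v'\<close> and
  \<open>\<theta> = n - 2k - (k+1)\<gamma>\<close>, which is positive precisely because \<open>q\<close> is supercritical. The function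
  \<open>V = c z\<^sup>q\<^sup>+\<^sup>1/(q+1) + k y\<^sup>k\<^sup>+\<^sup>1/(k+1) - \<gamma> z y\<^sup>k - \<theta> \<gamma>\<^sup>k z\<^sup>k\<^sup>+\<^sup>1/(k+1)\<close> satisfies
  \<open>r V' = \<theta> (y\<^sup>k - (\<gamma> z)\<^sup>k) (\<gamma> z - y) \<le> 0\<close> and is negative near \<open>r = 0\<close>, so it stays below a negative
  constant \<open>- \<delta>\<close>. Young's inequality turns this into \<open>\<delta> + c z\<^sup>q\<^sup>+\<^sup>1/(q+1) \<le> C z\<^sup>k\<^sup>+\<^sup>1\<close>, which bounds \<open>z\<close>
  from below (so \<open>v\<close> never vanishes) and from above; these are the two decay estimates.\<close>

section \<open>Hessians of the form scalar plus rank one\<close>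

text \<open>Evaluation at a point is a ring homomorphism. This reduces characteristic polynomials to
  determinants with real entries.\<close>

lemma poly_det: "poly (det M) x = det (\<chi> i j. poly (M $ i $ j) x)"
  for M :: "'a::comm_ring_1 poly^'n^'n"
  by (simp add: det_def poly_sum poly_prod sign_def)

text \<open>An orthogonal \<open>Q\<close> sending a coordinate axis to \<open>e\<close>
  diagonalises the matrix: the entry \<open>a - d\<close> occurs once, in the direction
  \<open>e\<close>, and \<open>a\<close> in all the others.\<close>

lemma det_scalar_minus_rank_one:
  fixes e :: "real^'n"
  assumes "norm e = 1"
  shows "det (\<chi> i j. (if i = j then a else 0) - d * e $ i * e $ j) = a ^ (CARD('n) - 1) * (a - d)"
proof -
  obtain l :: 'n and Q where Q: "orthogonal_matrix Q" and Qe: "Q *v axis l 1 = e"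
    using orthogonal_matrix_exists_basis[OF assms] by metis
  have QQ: "Q ** transpose Q = mat 1"
    using Q by (simp add: orthogonal_matrix_def)
  define D :: "real^'n^'n" where "D = (\<chi> i j. if i = j then (if i = l then a - d else a) else 0)"
  have col: "Q $ i $ l = e $ i" for i
    using Qe by (metis column_def matrix_vector_mult_basis vec_lambda_beta)
  have ent: "(\<Sum>m\<in>UNIV. Q $ i $ m * Q $ j $ m) = (if i = j then 1 else 0)" for i j
  proof -
    have "(Q ** transpose Q) $ i $ j = (\<Sum>m\<in>UNIV. Q $ i $ m * Q $ j $ m)"
      by (simp add: matrix_matrix_mult_def transpose_def)
    then show ?thesis using QQ by (simp add: mat_def)
  qed
  have QD: "(Q ** D) $ i $ m = Q $ i $ m * (if m = l then a - d else a)" for i m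
    by (simp add: matrix_matrix_mult_def D_def if_distrib[of "(*) _"] cong: if_cong)
  have "(Q ** D ** transpose Q) $ i $ j = (if i = j then a else 0) - d * e $ i * e $ j" for i j
  proof -
    have "(Q ** D ** transpose Q) $ i $ j = (\<Sum>m\<in>UNIV. (Q ** D) $ i $ m * Q $ j $ m)"
      by (simp add: matrix_matrix_mult_def[of "Q ** D"] transpose_def)
    also have "\<dots> = (\<Sum>m\<in>UNIV. a * (Q $ i $ m * Q $ j $ m)
        - (if m = l then d * Q $ i $ m * Q $ j $ m else 0))"
      by (rule sum.cong) (auto simp: QD algebra_simps)
    also have "\<dots> = a * (\<Sum>m\<in>UNIV. Q $ i $ m * Q $ j $ m) - d * Q $ i $ l * Q $ j $ l"
      by (simp add: sum_subtractf sum_distrib_left)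
    finally show ?thesis by (simp add: ent col)
  qed
  then have "(\<chi> i j. (if i = j then a else 0) - d * e $ i * e $ j) = Q ** D ** transpose Q"
    by (simp add: vec_eq_iff)
  then have "det (\<chi> i j. (if i = j then a else 0) - d * e $ i * e $ j) = det D * (det Q * det (transpose Q))"
    by (simp add: det_mul)
  also have "det Q * det (transpose Q) = 1"
    using QQ by (metis det_mul det_I)
  also have "det D = (\<Prod>i\<in>UNIV. if i = l then a - d else a)"
    by (subst det_diagonal) (auto simp: D_def)
  also have "\<dots> = a ^ (CARD('n) - 1) * (a - d)"
    by (subst prod.remove[of _ l]) auto
  finally show ?thesis by simp
qed

text \<open>The two polynomials agree at every real \<open>x\<close>, by the determinant above with
  \<open>a = x - g\<close>; over an infinite field this makes them equal.\<close>

lemma charpoly_scalar_plus_rank_one: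
  fixes e :: "real^'n"
  assumes "norm e = 1"
  shows "charpoly (\<chi> i j. (if i = j then g else 0) + d * e $ i * e $ j)
    = [:- g, 1:] ^ (CARD('n) - 1) * [:- (g + d), 1:]"
proof -
  have "poly (charpoly (\<chi> i j. (if i = j then g else 0) + d * e $ i * e $ j)) x
    = poly ([:- g, 1:] ^ (CARD('n) - 1) * [:- (g + d), 1:]) x" for x
  proof -
    have "poly (charpoly (\<chi> i j. (if i = j then g else 0) + d * e $ i * e $ j)) x
      = det (\<chi> i j. (if i = j then x - g else 0) - d * e $ i * e $ j)"
      unfolding charpoly_def poly_det by (rule arg_cong[where f = det]) (simp add: vec_eq_iff)
    then show ?thesis
      using det_scalar_minus_rank_one[OF assms, of "x - g" d] by (simp add: poly_power algebra_simps)
  qed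
  then show ?thesis by (simp add: poly_eq_poly_eq_iff[symmetric] fun_eq_iff)
qed

text \<open>The k-element index sets split into those avoiding \<open>p\<close> (family
  \<open>A\<close>) and those containing it, which are obtained from the (k-1)-element sets in
  \<open>B\<close> by inserting \<open>p\<close>.\<close>

lemma elem_sym_one_exception:
  assumes p: "p < length xs" and a: "xs ! p = a" and len: "length xs = n" and k: "k > 0"
    and b: "\<And>j. j < length xs \<Longrightarrow> j \<noteq> p \<Longrightarrow> xs ! j = b"
  shows "elem_sym k xs = real ((n - 1) choose (k - 1)) * a * b ^ (k - 1) + real ((n - 1) choose k) * b ^ k"
proof -
  define S where "S = {..<length xs} - {p}"
  have S: "finite S" "card S = n - 1" "p \<notin> S" using p len by (auto simp: S_def)
  define A where "A = {I. I \<subseteq> S \<and> card I = k}"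
  define B where "B = {I. I \<subseteq> S \<and> card I = k - 1}"
  have fin: "finite I" if "I \<subseteq> S" for I using that S finite_subset by blast
  have eq: "{I. I \<subseteq> {..<length xs} \<and> card I = k} = A \<union> insert p ` B"
  proof safe
    fix I assume I: "I \<subseteq> {..<length xs}" "k = card I" "I \<notin> insert p ` B"
    have fI: "finite I" using I finite_subset by blast
    show "I \<in> A"
    proof (cases "p \<in> I")
      case True
      then have "I = insert p (I - {p})" by auto
      moreover have "I - {p} \<in> B" using I True fI by (auto simp: B_def S_def)
      ultimately show ?thesis using I(3) by blast
    qed (use I in \<open>auto simp: A_def S_def\<close>)
  next
    fix I assume "I \<in> A" then show "card I = k" by (auto simp: A_def)
  next
    fix I j assume "I \<in> A" "j \<in> I" then show "j < length xs" by (auto simp: A_def S_def)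
  next
    fix I assume "I \<in> B" then show "card (insert p I) = k"
      using S fin k by (subst card_insert_disjoint) (auto simp: B_def)
  next
    fix I j assume "I \<in> B" "j \<in> I" then show "j < length xs" by (auto simp: B_def S_def)
  qed (use p in auto)
  have finAB: "finite A" "finite B" using S by (auto simp: A_def B_def)
  have disj: "A \<inter> insert p ` B = {}" using S by (auto simp: A_def)
  have inj: "inj_on (insert p) B"
    using S by (auto simp: inj_on_def B_def)
  have constb: "(\<Prod>i\<in>I. xs ! i) = b ^ card I" if "I \<subseteq> S" for I
  proof -
    have "(\<Prod>i\<in>I. xs ! i) = (\<Prod>i\<in>I. b)"
      by (rule prod.cong) (use that b in \<open>auto simp: S_def\<close>)
    then show ?thesis by simp
  qed
  have "elem_sym k xs = (\<Sum>I\<in>A. \<Prod>i\<in>I. xs ! i) + (\<Sum>I\<in>B. \<Prod>i\<in>insert p I. xs ! i)"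
    unfolding elem_sym_def eq using finAB disj inj by (simp add: sum.union_disjoint sum.reindex)
  also have "(\<Sum>I\<in>A. \<Prod>i\<in>I. xs ! i) = (\<Sum>I\<in>A. b ^ k)"
    by (rule sum.cong) (auto simp: A_def constb)
  also have "(\<Sum>I\<in>B. \<Prod>i\<in>insert p I. xs ! i) = (\<Sum>I\<in>B. a * b ^ (k - 1))"
  proof (rule sum.cong)
    fix I assume "I \<in> B"
    then have "I \<subseteq> S" "card I = k - 1" by (auto simp: B_def)
    then show "(\<Prod>i\<in>insert p I. xs ! i) = a * b ^ (k - 1)"
      using fin S a constb by (subst prod.insert) auto
  qed simp
  finally show ?thesis
    using S by (simp add: A_def B_def n_subsets)
qed

lemma k_Hessian_op_scalar_plus_rank_one:
  fixes e :: "real^'n"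
  assumes "norm e = 1" and k: "k > 0"
  shows "k_Hessian_op k (\<chi> i j. (if i = j then g else 0) + d * e $ i * e $ j)
    = real ((CARD('n) - 1) choose (k - 1)) * (g + d) * g ^ (k - 1) + real ((CARD('n) - 1) choose k) * g ^ k"
proof -
  define xs where "xs = eigenvals (\<chi> i j. (if i = j then g else 0) + d * e $ i * e $ j)"
  have ms: "mset xs = add_mset (g + d) (replicate_mset (CARD('n) - 1) g)"
    unfolding xs_def eigenvals_def charpoly_scalar_plus_rank_one[OF assms(1)]
    by (subst proots_mult) (auto simp: proots_power simp del: mult_pCons_left mult_pCons_right)
  then have len: "length xs = CARD('n)"
    by (metis One_nat_def Suc_pred size_add_mset size_mset size_replicate_mset zero_less_card_finite)
  have "g + d \<in> set xs" using ms by (metis set_mset_mset union_single_eq_member)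
  \<comment> \<open>Sorting may put \<open>g + d\<close> at any position. Exactly one occurrence is
    split off, so the case \<open>d = 0\<close> is covered as well.\<close>
  then obtain ys zs where xs: "xs = ys @ (g + d) # zs" by (meson split_list)
  then have "mset (ys @ zs) = replicate_mset (CARD('n) - 1) g" using ms by simp
  then have g: "x = g" if "x \<in> set (ys @ zs)" for x
    using that by (metis in_replicate_mset set_mset_mset)
  show ?thesis
    unfolding k_Hessian_op_def xs_def[symmetric]
  proof (rule elem_sym_one_exception[where p = "length ys"])
    fix j assume "j < length xs" "j \<noteq> length ys"
    then have "xs ! j \<in> set (ys @ zs)"
      by (auto simp: xs nth_append nth_Cons' intro: nth_mem)
    then show "xs ! j = g" using g by blast
  qed (use len xs k in auto)
qed

section \<open>Picard iteration for the truncated radial equation\<close>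

lemma powr_root_lipschitz:
  fixes a m x y :: real
  assumes "0 < m" "0 \<le> a" "a \<le> 1" "m \<le> x" "m \<le> y"
  shows "\<bar>x powr a - y powr a\<bar> \<le> a * m powr (a - 1) * \<bar>x - y\<bar>"
proof -
  have "norm (x powr a - y powr a) \<le> (a * m powr (a - 1)) * norm (x - y)"
  proof (rule field_differentiable_bound[of "{m..}" "\<lambda>x. x powr a" "\<lambda>x. a * x powr (a - 1)"])
    fix z assume z: "z \<in> {m..}"
    then show "((\<lambda>x. x powr a) has_real_derivative a * z powr (a - 1)) (at z within {m..})"
      using assms by (intro has_field_derivative_at_within[OF has_real_derivative_powr]) auto
    have "z powr (a - 1) \<le> m powr (a - 1)"
      using z assms by (intro powr_mono2') auto
    then show "norm (a * z powr (a - 1)) \<le> a * m powr (a - 1)"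
      using assms mult_left_mono[of "z powr (a - 1)" "m powr (a - 1)" a] by (simp add: abs_mult)
  qed (use assms in auto)
  then show ?thesis by simp
qed

text \<open>Mean value theorem with derivative at most \<open>q\<close> on the unit interval. The
  derivative is used only at interior points, so an endpoint at 0 does no harm.\<close>

lemma powr_unit_lipschitz:
  fixes a b q :: real
  assumes "0 \<le> a" "a \<le> 1" "0 \<le> b" "b \<le> 1" "1 \<le> q"
  shows "\<bar>a powr q - b powr q\<bar> \<le> q * \<bar>a - b\<bar>"
proof -
  have *: "\<bar>a powr q - b powr q\<bar> \<le> q * \<bar>a - b\<bar>"
    if ab: "0 \<le> a" "a < b" "b \<le> 1" for a b :: real
  proof -
    have "continuous_on {a..b} (\<lambda>x. x powr q)"
      using assms(5) that by (intro continuous_on_powr' continuous_intros) auto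
    moreover have "((\<lambda>x. x powr q) has_derivative (*) (q * x powr (q - 1))) (at x)" if "a < x" "x < b" for x
      using has_real_derivative_powr[of x q] that ab by (simp add: has_field_derivative_def)
    ultimately obtain x where x: "a < x" "x < b" "b powr q - a powr q = q * x powr (q - 1) * (b - a)"
      using mvt[OF ab(2), of "\<lambda>x. x powr q" "\<lambda>x. (*) (q * x powr (q - 1))"] by auto
    have "x powr (q - 1) \<le> 1" using x ab assms(5) by (simp add: powr_le1)
    then have "q * x powr (q - 1) * (b - a) \<le> q * (b - a)" "0 \<le> q * x powr (q - 1) * (b - a)"
      using assms(5) ab by (auto simp: mult_left_le)
    then show ?thesis using x ab by auto
  qed
  show ?thesis
  proof (cases a b rule: linorder_cases)
    case greater
    then show ?thesis using *[of b a] assms by (simp add: abs_minus_commute)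
  qed (use * assms in auto)
qed

section \<open>Continuity and differentiation on half-lines\<close>

lemma at_within_atLeast_eq_Icc:
  fixes a b x :: real
  assumes "x < b"
  shows "at x within {a..} = at x within {a..b}"
  by (rule at_within_nhd[of _ "{..<b}"]) (use assms in auto)

lemma continuous_on_atLeast_if_Icc:
  fixes f :: "real \<Rightarrow> real"
  assumes "\<And>b. a < b \<Longrightarrow> continuous_on {a..b} f"
  shows "continuous_on {a..} f"
  unfolding continuous_on_eq_continuous_within
proof
  fix x assume "x \<in> {a..}"
  then have "continuous (at x within {a..x+1}) f"
    using assms[of "x+1"] by (auto simp: continuous_on_eq_continuous_within)
  then show "continuous (at x within {a..}) f"
    by (simp add: at_within_atLeast_eq_Icc[of x "x+1"])
qed

lemma continuous_on_integral_from:
  fixes g :: "real \<Rightarrow> real"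
  assumes "continuous_on {a..} g"
  shows "continuous_on {a..} (\<lambda>r. integral {a..r} g)"
proof (rule continuous_on_atLeast_if_Icc)
  fix b assume "a < b"
  have "continuous_on {a..b} g" by (rule continuous_on_subset[OF assms]) auto
  then show "continuous_on {a..b} (\<lambda>r. integral {a..r} g)"
    by (intro indefinite_integral_continuous_1 integrable_continuous_real)
qed

lemma has_real_derivative_integral_from:
  fixes g :: "real \<Rightarrow> real"
  assumes "continuous_on {a..} g" "a < t"
  shows "((\<lambda>r. integral {a..r} g) has_real_derivative g t) (at t)"
proof -
  have "continuous_on {a..t+1} g" by (rule continuous_on_subset[OF assms(1)]) auto
  then have "((\<lambda>r. integral {a..r} g) has_real_derivative g t) (at t within {a..t+1})"
    using assms by (intro integral_has_real_derivative) auto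
  moreover have "at t within {a..t+1} = at t"
    using assms by (intro at_within_interior) auto
  ultimately show ?thesis by simp
qed

section \<open>Integrals with the radial weight \<open>s ^ (n - 1)\<close>\<close>

lemma has_integral_monomial:
  fixes t :: real
  assumes "0 < n" "0 \<le> t"
  shows "((\<lambda>s. s ^ (n - 1)) has_integral t ^ n / real n) {0..t}"
proof -
  have "((\<lambda>s. s ^ (n - 1)) has_integral t ^ n / real n - 0 ^ n / real n) {0..t}"
    using assms by (intro fundamental_theorem_of_calculus)
      (auto intro!: derivative_eq_intros simp: has_real_derivative_iff_has_vector_derivative[symmetric])
  then show ?thesis using assms by (simp add: zero_power)
qed

lemma weighted_integral_abs_le:
  fixes t :: real
  assumes "0 < n" "0 \<le> t" "continuous_on {0..t} g" "\<And>s. s \<in> {0..t} \<Longrightarrow> \<bar>g s\<bar> \<le> E"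
  shows "\<bar>integral {0..t} (\<lambda>s. s ^ (n - 1) * g s)\<bar> \<le> E * t ^ n / real n"
proof -
  have h: "((\<lambda>s. E * s ^ (n - 1)) has_integral E * (t ^ n / real n)) {0..t}"
    by (intro has_integral_mult_right has_integral_monomial assms)
  have "norm (integral {0..t} (\<lambda>s. s ^ (n - 1) * g s)) \<le> integral {0..t} (\<lambda>s. E * s ^ (n - 1))"
  proof (rule integral_norm_bound_integral)
    show "(\<lambda>s. s ^ (n - 1) * g s) integrable_on {0..t}"
      by (intro integrable_continuous_real continuous_intros assms)
    show "(\<lambda>s. E * s ^ (n - 1)) integrable_on {0..t}" using h by blast
    fix s assume s: "s \<in> {0..t}"
    show "norm (s ^ (n - 1) * g s) \<le> E * s ^ (n - 1)"
      using assms(4)[OF s] s by (simp add: abs_mult mult.commute mult_right_mono)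
  qed
  also have "\<dots> = E * t ^ n / real n" unfolding integral_unique[OF h] by simp
  finally show ?thesis by simp
qed

lemma weighted_integral_ge:
  fixes t :: real
  assumes "0 < n" "0 \<le> t" "continuous_on {0..t} g" "\<And>s. s \<in> {0..t} \<Longrightarrow> E \<le> g s"
  shows "E * t ^ n / real n \<le> integral {0..t} (\<lambda>s. s ^ (n - 1) * g s)"
proof -
  have h: "((\<lambda>s. E * s ^ (n - 1)) has_integral E * (t ^ n / real n)) {0..t}"
    by (intro has_integral_mult_right has_integral_monomial assms)
  have "integral {0..t} (\<lambda>s. E * s ^ (n - 1)) \<le> integral {0..t} (\<lambda>s. s ^ (n - 1) * g s)"
  proof (rule integral_le)
    show "(\<lambda>s. s ^ (n - 1) * g s) integrable_on {0..t}"
      by (intro integrable_continuous_real continuous_intros assms)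
    show "(\<lambda>s. E * s ^ (n - 1)) integrable_on {0..t}" using h by blast
    fix s assume s: "s \<in> {0..t}"
    show "E * s ^ (n - 1) \<le> s ^ (n - 1) * g s"
      using mult_right_mono[OF assms(4)[OF s], of "s ^ (n - 1)"] s by (simp add: mult.commute)
  qed
  then show ?thesis unfolding integral_unique[OF h] by simp
qed

text \<open>The constant \<open>c\<close> absorbs the binomial factor that the elementary symmetric
  polynomial produces; the equation for \<open>u\<close> will need
  \<open>c = k / ((n - 1) choose (k - 1))\<close>, while the analysis of the profile works for every
  positive \<open>c\<close>.\<close>

locale radial_k_Hessian =
  fixes n k :: nat and q c :: real
  assumes c_pos: "0 < c" and k_gt1: "1 < k" and n_gt: "2 * k < n"
    and q_supercritical: "q > (real n + 2) * real k / (real n - 2 * real k)"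
begin

text \<open>The critical exponent is at least \<open>k\<close> because \<open>n + 2\<close> exceeds
  \<open>n - 2k\<close>. This makes the decay rate positive.\<close>

lemma q_gt_k: "q > real k"
proof -
  have p: "real n - 2 * real k > 0" using n_gt by linarith
  have "real k * (real n - 2 * real k) \<le> (real n + 2) * real k"
    by (simp add: algebra_simps)
  then have "real k \<le> (real n + 2) * real k / (real n - 2 * real k)"
    using p by (simp add: pos_le_divide_eq)
  then show ?thesis using q_supercritical by linarith
qed

lemma q_gt1: "q > 1" using q_gt_k k_gt1 by linarith

lemma n_pos: "0 < n" using n_gt by simp

text \<open>The nonlinearity is truncated to values \<open>v \<in> [0, 1]\<close>; the solution constructed below is shown
  afterwards to stay in \<open>(0, 1]\<close>.\<close>
definition source :: "real \<Rightarrow> real" where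
  "source x = (max 0 (min x 1)) powr q"

text \<open>With \<open>u(x) = - v(|x|)\<close> the equation reads \<open>(r\<^sup>n\<^sup>-\<^sup>k (- v')\<^sup>k)' = c r\<^sup>n\<^sup>-\<^sup>1 v\<^sup>q\<close>, and \<open>flux v r\<close> is
  \<open>(- v'(r) / r)\<^sup>k\<close>; its value at \<open>0\<close> is the continuous extension.\<close>
definition flux :: "(real \<Rightarrow> real) \<Rightarrow> real \<Rightarrow> real" where
  "flux v t = (if t = 0 then c * source (v 0) / real n
     else c * integral {0..t} (\<lambda>s. s ^ (n - 1) * source (v s)) / t ^ n)"

definition picard :: "(real \<Rightarrow> real) \<Rightarrow> real \<Rightarrow> real" where
  "picard v r = 1 - integral {0..r} (\<lambda>t. t * flux v t powr (1 / real k))"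

section \<open>Estimates and regularity of the flux\<close>

lemma source_nonneg: "0 \<le> source x" and source_le1: "source x \<le> 1"
  using q_gt1 by (auto simp: source_def intro!: powr_le1)

lemma source_lipschitz: "\<bar>source x - source y\<bar> \<le> q * \<bar>x - y\<bar>"
proof -
  have "\<bar>source x - source y\<bar> \<le> q * \<bar>max 0 (min x 1) - max 0 (min y 1)\<bar>"
    unfolding source_def using q_gt1 by (intro powr_unit_lipschitz) auto
  also have "\<dots> \<le> q * \<bar>x - y\<bar>" using q_gt1 by (intro mult_left_mono) auto
  finally show ?thesis .
qed

lemma continuous_on_source: "continuous_on A v \<Longrightarrow> continuous_on A (\<lambda>s. source (v s))"
  unfolding source_def using q_gt1 by (intro continuous_on_powr' continuous_intros) auto

lemma source_ge: "1 / 2 \<le> x \<Longrightarrow> (1 / 2) powr q \<le> source x"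
  unfolding source_def using q_gt1 by (intro powr_mono2) auto

lemma flux_nonneg: "0 \<le> t \<Longrightarrow> 0 \<le> flux v t"
proof -
  assume t: "0 \<le> t"
  have "0 \<le> integral {0..t} (\<lambda>s. s ^ (n - 1) * source (v s))"
    \<comment> \<open>For arbitrary \<open>v\<close> the integrand may fail to be integrable; the
      integral then has the default value 0, which is nonnegative too.\<close>
    by (cases "(\<lambda>s. s ^ (n - 1) * source (v s)) integrable_on {0..t}")
      (auto intro!: integral_nonneg simp: source_nonneg not_integrable_integral)
  then show ?thesis using t c_pos by (simp add: flux_def source_nonneg)
qed

text \<open>Integrating the weight gives \<open>t ^ n / n\<close>, which cancels the division by
  \<open>t ^ n\<close>. The Lipschitz constant is therefore uniform in \<open>t\<close>, down to
  \<open>t = 0\<close>.\<close>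

lemma flux_diff_le:
  assumes v1: "continuous_on {0..t} v1" and v2: "continuous_on {0..t} v2" and t: "0 \<le> t"
    and E: "\<And>s. s \<in> {0..t} \<Longrightarrow> \<bar>v1 s - v2 s\<bar> \<le> E"
  shows "\<bar>flux v1 t - flux v2 t\<bar> \<le> c * q / real n * E"
proof -
  have E': "\<bar>source (v1 s) - source (v2 s)\<bar> \<le> q * E" if "s \<in> {0..t}" for s
    using source_lipschitz[of "v1 s" "v2 s"] E[OF that] q_gt1
    by (meson dual_order.trans mult_left_mono less_imp_le zero_less_one order_less_trans)
  show ?thesis
  proof (cases "t = 0")
    case True
    have "\<bar>flux v1 t - flux v2 t\<bar> = c / real n * \<bar>source (v1 0) - source (v2 0)\<bar>"
      using True c_pos n_pos by (simp add: flux_def abs_mult diff_divide_distrib[symmetric] right_diff_distrib[symmetric])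
    also have "\<dots> \<le> c / real n * (q * E)"
      using E'[of 0] True c_pos by (intro mult_left_mono) auto
    finally show ?thesis by (simp add: mult.assoc)
  next
    case False
    then have t0: "t > 0" using t by simp
    have "integral {0..t} (\<lambda>s. s ^ (n - 1) * source (v1 s)) - integral {0..t} (\<lambda>s. s ^ (n - 1) * source (v2 s))
       = integral {0..t} (\<lambda>s. s ^ (n - 1) * (source (v1 s) - source (v2 s)))"
      by (subst integral_diff[symmetric])
        (auto intro!: integrable_continuous_real continuous_intros continuous_on_source v1 v2 simp: right_diff_distrib)
    then have "\<bar>flux v1 t - flux v2 t\<bar>
      = c / t ^ n * \<bar>integral {0..t} (\<lambda>s. s ^ (n - 1) * (source (v1 s) - source (v2 s)))\<bar>"
      using t0 c_pos by (simp add: flux_def abs_mult diff_divide_distrib[symmetric] right_diff_distrib[symmetric])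
    also have "\<dots> \<le> c / t ^ n * (q * E * t ^ n / real n)"
      using c_pos t0 E' n_pos
      by (intro mult_left_mono weighted_integral_abs_le continuous_intros continuous_on_source v1 v2) auto
    also have "\<dots> = c * q / real n * E" using t0 by simp
    finally show ?thesis .
  qed
qed

text \<open>Shows that the value prescribed at \<open>t = 0\<close> is the right one; it serves as
  the comparison function for continuity there.\<close>

lemma flux_const: "0 \<le> t \<Longrightarrow> flux (\<lambda>_. a) t = c * source a / real n"
  using integral_unique[OF has_integral_mult_left[OF has_integral_monomial[OF n_pos]], of t "source a"]
  by (auto simp: flux_def)

lemma flux_le:
  assumes "continuous_on {0..t} v" "0 \<le> t"
  shows "flux v t \<le> c / real n"
proof (cases "t = 0")
  case True
  then show ?thesis using c_pos source_le1 by (simp add: flux_def divide_right_mono)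
next
  case False
  then have t0: "t > 0" using assms by simp
  have "\<bar>integral {0..t} (\<lambda>s. s ^ (n - 1) * source (v s))\<bar> \<le> 1 * t ^ n / real n"
    using n_pos assms source_le1 source_nonneg
    by (intro weighted_integral_abs_le continuous_on_source) auto
  then have "c * integral {0..t} (\<lambda>s. s ^ (n - 1) * source (v s)) \<le> c * (t ^ n / real n)"
    using c_pos by (intro mult_left_mono) auto
  then show ?thesis using t0 by (simp add: flux_def divide_le_eq)
qed

text \<open>Up to \<rho> the source is at least \<open>(1 / 2) powr q\<close>, which bounds its
  weighted mean. Beyond \<rho> only the integral over \<open>[0, \<rho>]\<close> is kept, and
  \<open>t ^ n \<le> R ^ n\<close>.\<close>

lemma flux_ge:
  assumes v: "continuous_on {0..} v" and half: "\<And>s. s \<in> {0..\<rho>} \<Longrightarrow> 1 / 2 \<le> v s"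
    and \<rho>: "0 < \<rho>" "\<rho> \<le> R" and t: "t \<in> {0..R}"
  shows "c / real n * (1 / 2) powr q * (\<rho> / R) ^ n \<le> flux v t"
proof -
  have v': "continuous_on {0..a} v" for a by (rule continuous_on_subset[OF v]) auto
  define h where "h = (1 / 2 :: real) powr q"
  have h: "0 < h" by (simp add: h_def)
  have le1: "(\<rho> / R) ^ n \<le> 1" using \<rho> by (intro power_le_one) auto
  then have "c / real n * h * (\<rho> / R) ^ n \<le> c / real n * h * 1"
    using h c_pos by (intro mult_left_mono) auto
  then have le2: "c / real n * h * (\<rho> / R) ^ n \<le> c / real n * h" by simp
  consider "t = 0" | "0 < t" "t \<le> \<rho>" | "\<rho> < t" using t by fastforce
  then have "c / real n * h * (\<rho> / R) ^ n \<le> flux v t"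
  proof cases
    case 1
    have "c / real n * h \<le> c / real n * source (v 0)"
      unfolding h_def using c_pos half[of 0] \<rho> by (intro mult_left_mono source_ge) auto
    then show ?thesis using 1 le2 by (simp add: flux_def)
  next
    case 2
    have "h * t ^ n / real n \<le> integral {0..t} (\<lambda>s. s ^ (n - 1) * source (v s))"
      unfolding h_def using 2 half n_pos by (intro weighted_integral_ge continuous_on_source v' source_ge) auto
    then have "c * (h * t ^ n / real n) / t ^ n
        \<le> c * integral {0..t} (\<lambda>s. s ^ (n - 1) * source (v s)) / t ^ n"
      using 2 c_pos by (intro divide_right_mono mult_left_mono) auto
    then have "c * (h * t ^ n / real n) / t ^ n \<le> flux v t"
      using 2 by (simp add: flux_def)
    then show ?thesis using 2 le2 by simp
  next
    case 3
    have "h * \<rho> ^ n / real n \<le> integral {0..\<rho>} (\<lambda>s. s ^ (n - 1) * source (v s))"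
      unfolding h_def using \<rho> half n_pos by (intro weighted_integral_ge continuous_on_source v' source_ge) auto
    also have "\<dots> \<le> integral {0..t} (\<lambda>s. s ^ (n - 1) * source (v s))"
      using 3 source_nonneg
      by (intro integral_subset_le integrable_continuous_real continuous_intros continuous_on_source v') auto
    finally have "c * (h * \<rho> ^ n / real n) / t ^ n
        \<le> c * integral {0..t} (\<lambda>s. s ^ (n - 1) * source (v s)) / t ^ n"
      using 3 \<rho> c_pos by (intro divide_right_mono mult_left_mono) auto
    then have "c * (h * \<rho> ^ n / real n) / t ^ n \<le> flux v t"
      using 3 \<rho> by (simp add: flux_def)
    moreover have "c / real n * h * (\<rho> / R) ^ n \<le> c * (h * \<rho> ^ n / real n) / t ^ n"
    proof -
      have "\<rho> ^ n / R ^ n \<le> \<rho> ^ n / t ^ n"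
        using 3 \<rho> t by (intro divide_left_mono power_mono) auto
      then have "c / real n * h * (\<rho> ^ n / R ^ n) \<le> c / real n * h * (\<rho> ^ n / t ^ n)"
        using c_pos h by (intro mult_left_mono) auto
      then show ?thesis by (simp add: power_divide)
    qed
    ultimately show ?thesis by linarith
  qed
  then show ?thesis by (simp add: h_def)
qed

lemma flux_has_derivative:
  assumes v: "continuous_on {0..} v" and t: "0 < t"
  shows "(flux v has_real_derivative (c * source (v t) - real n * flux v t) / t) (at t)"
proof -
  define I where "I = (\<lambda>t. integral {0..t} (\<lambda>s. s ^ (n - 1) * source (v s)))"
  have I: "(I has_real_derivative t ^ (n - 1) * source (v t)) (at t)"
    unfolding I_def using t
    by (intro has_real_derivative_integral_from continuous_intros continuous_on_source v) auto
  have "((\<lambda>t. c * I t / t ^ n) has_real_derivative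
     (c * (t ^ (n - 1) * source (v t)) * t ^ n - c * I t * (real n * t ^ (n - 1))) / (t ^ n * t ^ n)) (at t)"
    using t by (auto intro!: derivative_eq_intros I)
  moreover have "(c * (t ^ (n - 1) * source (v t)) * t ^ n - c * I t * (real n * t ^ (n - 1))) / (t ^ n * t ^ n)
     = (c * source (v t) - real n * flux v t) / t"
  proof -
    have tn: "t ^ n = t * t ^ (n - 1)" using n_pos by (cases n) auto
    have fl: "flux v t = c * I t / t ^ n" using t by (simp add: flux_def I_def)
    have "t ^ (n - 1) > 0" using t by simp
    then show ?thesis using t unfolding fl tn by (simp add: field_simps)
  qed
  ultimately have "((\<lambda>t. c * I t / t ^ n) has_real_derivative (c * source (v t) - real n * flux v t) / t) (at t)"
    by simp
  then show ?thesis
    by (rule has_field_derivative_transform_within_open[of _ _ _ "{0<..}"])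
      (use t in \<open>auto simp: flux_def I_def\<close>)
qed

lemma continuous_on_flux:
  assumes v: "continuous_on {0..} v"
  shows "continuous_on {0..} (flux v)"
  unfolding continuous_on_eq_continuous_within
proof
  fix t :: real assume "t \<in> {0..}"
  then consider "t > 0" | "t = 0" by fastforce
  then show "continuous (at t within {0..}) (flux v)"
  proof cases
    case 1
    then show ?thesis
      using flux_has_derivative[OF v 1] DERIV_isCont continuous_at_imp_continuous_at_within by blast
  next
    case 2
    show ?thesis unfolding continuous_within_eps_delta
    proof safe
      fix e :: real assume e: "0 < e"
      define e' where "e' = e / (2 * (c * q / real n))"
      have cq: "0 < c * q / real n" using c_pos q_gt1 n_pos by simp
      then have e': "e' > 0" using e c_pos q_gt1 n_pos by (simp add: e'_def)
      have "continuous (at 0 within {0..}) v"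
        using v by (auto simp: continuous_on_eq_continuous_within)
      then obtain d where d: "d > 0" "\<And>s. s \<in> {0..} \<Longrightarrow> dist s 0 < d \<Longrightarrow> dist (v s) (v 0) < e'"
        using e' unfolding continuous_within_eps_delta by blast
      have "dist (flux v s) (flux v t) < e" if s: "s \<ge> 0" "dist s t < d" for s
      proof -
        \<comment> \<open>Near 0 the function \<open>v\<close> is compared with the constant
          \<open>v 0\<close>, whose flux does not depend on \<open>s\<close>; \<open>e'\<close> is
          chosen so that the Lipschitz bound gives \<open>e / 2\<close>.\<close>
        have "\<bar>flux v s - flux (\<lambda>_. v 0) s\<bar> \<le> c * q / real n * e'"
        proof (rule flux_diff_le)
          show "continuous_on {0..s} v" by (rule continuous_on_subset[OF v]) auto
          fix x assume "x \<in> {0..s}"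
          then show "\<bar>v x - v 0\<bar> \<le> e'" using d(2)[of x] s 2 by (auto simp: dist_real_def)
        qed (use s in auto)
        also have "\<dots> = e / 2" using c_pos q_gt1 n_pos by (simp add: e'_def)
        finally have "\<bar>flux v s - flux (\<lambda>_. v 0) s\<bar> < e" using e by linarith
        moreover have "flux (\<lambda>_. v 0) s = flux v 0" using s flux_const[of s "v 0"] by (simp add: flux_def)
        ultimately show ?thesis using 2 by (simp add: dist_real_def)
      qed
      then show "\<exists>d>0. \<forall>x'\<in>{0..}. dist x' t < d \<longrightarrow> dist (flux v x') (flux v t) < e"
        using d(1) by (intro exI[of _ d]) auto
    qed
  qed
qed

section \<open>The Picard operator and its fixed point\<close>

lemma continuous_on_picard_integrand:
  assumes "continuous_on {0..} v"
  shows "continuous_on {0..} (\<lambda>t. t * flux v t powr (1 / real k))"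
  using k_gt1 flux_nonneg
  by (intro continuous_intros continuous_on_powr' continuous_on_flux assms) auto

lemma continuous_on_picard:
  assumes "continuous_on {0..} v"
  shows "continuous_on {0..} (picard v)"
  unfolding picard_def[abs_def]
  by (intro continuous_intros continuous_on_integral_from continuous_on_picard_integrand assms)

lemma picard_has_derivative:
  assumes "continuous_on {0..} v" "0 < t"
  shows "(picard v has_real_derivative - (t * flux v t powr (1 / real k))) (at t)"
  unfolding picard_def[abs_def]
  using has_real_derivative_integral_from[OF continuous_on_picard_integrand[OF assms(1)] assms(2)]
  by (auto intro!: derivative_eq_intros)

text \<open>Upper bound for \<open>- v'(r) / r\<close>, the k-th root of the bound
  \<open>c / n\<close> on the flux.\<close>

definition slope :: real where "slope = (c / real n) powr (1 / real k)"

lemma slope_pos: "0 < slope" using c_pos n_pos by (simp add: slope_def)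

text \<open>These bounds hold uniformly in \<open>v\<close>. The quadratic lower bound keeps all
  iterates above \<open>1 / 2\<close> on a common interval, as the flux bound from below
  requires.\<close>

lemma picard_bounds:
  assumes v: "continuous_on {0..} v" and r: "0 \<le> r"
  shows "picard v r \<le> 1" "1 - slope * r\<^sup>2 / 2 \<le> picard v r"
proof -
  have sub: "continuous_on {0..r} (\<lambda>t. t * flux v t powr (1 / real k))"
    by (rule continuous_on_subset[OF continuous_on_picard_integrand[OF v]]) auto
  have "0 \<le> integral {0..r} (\<lambda>t. t * flux v t powr (1 / real k))"
    by (intro integral_nonneg integrable_continuous_real sub) auto
  then show "picard v r \<le> 1" by (simp add: picard_def)
  have h: "((\<lambda>t. slope * t ^ (2 - 1)) has_integral slope * (r ^ 2 / real 2)) {0..r}"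
    by (intro has_integral_mult_right has_integral_monomial) (use r in auto)
  have "integral {0..r} (\<lambda>t. t * flux v t powr (1 / real k)) \<le> integral {0..r} (\<lambda>t. slope * t ^ (2 - 1))"
  proof (rule integral_le)
    fix t assume t: "t \<in> {0..r}"
    have "flux v t powr (1 / real k) \<le> slope"
      unfolding slope_def using t
      by (intro powr_mono2 flux_nonneg flux_le continuous_on_subset[OF v]) auto
    then show "t * flux v t powr (1 / real k) \<le> slope * t ^ (2 - 1)"
      using t mult_left_mono[of "flux v t powr (1 / real k)" slope t] by (simp add: mult.commute)
  qed (use h sub in \<open>auto intro: integrable_continuous_real\<close>)
  then show "1 - slope * r\<^sup>2 / 2 \<le> picard v r"
    unfolding integral_unique[OF h] by (simp add: picard_def)
qed

text \<open>The root is Lipschitz only away from \<open>0\<close>. The flux stays away from \<open>0\<close> on \<open>[0, R]\<close> because the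
  mass of the source on \<open>[0, \<rho>]\<close> is never lost; the Gaussian weight then absorbs the Lipschitz constant.\<close>
lemma picard_contraction:
  assumes \<rho>: "0 < \<rho>" "\<rho> \<le> R"
  shows "\<exists>K>0. \<forall>v1 v2 D r. continuous_on {0..} v1 \<longrightarrow> continuous_on {0..} v2 \<longrightarrow>
       (\<forall>s\<in>{0..\<rho>}. 1 / 2 \<le> v1 s) \<longrightarrow> (\<forall>s\<in>{0..\<rho>}. 1 / 2 \<le> v2 s) \<longrightarrow>
       (\<forall>s\<in>{0..R}. \<bar>v1 s - v2 s\<bar> \<le> D * exp (K * s\<^sup>2)) \<longrightarrow> 0 \<le> D \<longrightarrow> r \<in> {0..R} \<longrightarrow>
       \<bar>picard v1 r - picard v2 r\<bar> \<le> D / 2 * exp (K * r\<^sup>2)"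
proof -
  \<comment> \<open>\<open>m\<close> is the lower bound for the flux on \<open>[0, R]\<close>,
    \<open>L\<close> the Lipschitz constant of the k-th root on \<open>[m, \<infinity>)\<close>, and
    \<open>K\<close> the product of \<open>L\<close> with the Lipschitz constant of the
    flux.\<close>
  define m where "m = c / real n * (1 / 2) powr q * (\<rho> / R) ^ n"
  have m: "0 < m" using \<rho> c_pos n_pos by (simp add: m_def)
  define L where "L = 1 / real k * m powr (1 / real k - 1)"
  have L: "0 < L" using m k_gt1 by (simp add: L_def)
  define K where "K = L * (c * q / real n)"
  have K: "0 < K" using L c_pos q_gt1 n_pos by (simp add: K_def)
  have "\<bar>picard v1 r - picard v2 r\<bar> \<le> D / 2 * exp (K * r\<^sup>2)"
    if v1: "continuous_on {0..} v1" and v2: "continuous_on {0..} v2"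
      and h1: "\<And>s. s \<in> {0..\<rho>} \<Longrightarrow> 1 / 2 \<le> v1 s" and h2: "\<And>s. s \<in> {0..\<rho>} \<Longrightarrow> 1 / 2 \<le> v2 s"
      and D: "\<And>s. s \<in> {0..R} \<Longrightarrow> \<bar>v1 s - v2 s\<bar> \<le> D * exp (K * s\<^sup>2)" "0 \<le> D" and r: "r \<in> {0..R}"
    for v1 v2 D r
  proof -
    have sub: "continuous_on {0..r} (\<lambda>t. t * flux v t powr (1 / real k))" if "continuous_on {0..} v" for v
      by (rule continuous_on_subset[OF continuous_on_picard_integrand[OF that]]) auto
    \<comment> \<open>The contraction factor \<open>1 / 2\<close> arises here:
      \<open>K * t * exp (K * t^2)\<close> has the primitive \<open>exp (K * t^2) / 2\<close>,
      whatever \<open>K\<close> is.\<close>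
    have int: "((\<lambda>t. D * (K * t * exp (K * t\<^sup>2))) has_integral D * (exp (K * r\<^sup>2) / 2 - exp (K * 0\<^sup>2) / 2)) {0..r}"
      using r by (intro has_integral_mult_right fundamental_theorem_of_calculus)
        (auto intro!: derivative_eq_intros simp: has_real_derivative_iff_has_vector_derivative[symmetric])
    have bd: "\<bar>t * flux v1 t powr (1 / real k) - t * flux v2 t powr (1 / real k)\<bar> \<le> D * (K * t * exp (K * t\<^sup>2))"
      if t: "t \<in> {0..r}" for t
    proof -
      have tR: "t \<in> {0..R}" using t r by auto
      have fd: "\<bar>flux v1 t - flux v2 t\<bar> \<le> c * q / real n * (D * exp (K * t\<^sup>2))"
      proof (rule flux_diff_le)
        show "continuous_on {0..t} v1" "continuous_on {0..t} v2"
          by (auto intro: continuous_on_subset[OF v1] continuous_on_subset[OF v2])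
        fix s assume s: "s \<in> {0..t}"
        have "D * exp (K * s\<^sup>2) \<le> D * exp (K * t\<^sup>2)"
          using s K D(2) by (intro mult_left_mono) auto
        then show "\<bar>v1 s - v2 s\<bar> \<le> D * exp (K * t\<^sup>2)"
          using D(1)[of s] s tR by force
      qed (use t in auto)
      have "\<bar>flux v1 t powr (1 / real k) - flux v2 t powr (1 / real k)\<bar> \<le> L * \<bar>flux v1 t - flux v2 t\<bar>"
        unfolding L_def using m k_gt1 flux_ge[OF v1 h1 \<rho> tR] flux_ge[OF v2 h2 \<rho> tR]
        by (intro powr_root_lipschitz) (auto simp: m_def)
      also have "\<dots> \<le> L * (c * q / real n * (D * exp (K * t\<^sup>2)))"
        using L fd by (intro mult_left_mono) auto
      also have "\<dots> = K * D * exp (K * t\<^sup>2)" by (simp add: K_def)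
      finally have "t * \<bar>flux v1 t powr (1 / real k) - flux v2 t powr (1 / real k)\<bar> \<le> t * (K * D * exp (K * t\<^sup>2))"
        using t by (intro mult_left_mono) auto
      moreover have "\<bar>t * flux v1 t powr (1 / real k) - t * flux v2 t powr (1 / real k)\<bar>
          = t * \<bar>flux v1 t powr (1 / real k) - flux v2 t powr (1 / real k)\<bar>"
        using t by (simp add: right_diff_distrib[symmetric] abs_mult)
      ultimately show ?thesis by (simp add: ac_simps)
    qed
    have "picard v1 r - picard v2 r = - integral {0..r} (\<lambda>t. t * flux v1 t powr (1 / real k) - t * flux v2 t powr (1 / real k))"
      unfolding picard_def by (subst integral_diff) (auto intro!: integrable_continuous_real sub v1 v2)
    moreover have "norm (integral {0..r} (\<lambda>t. t * flux v1 t powr (1 / real k) - t * flux v2 t powr (1 / real k)))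
       \<le> integral {0..r} (\<lambda>t. D * (K * t * exp (K * t\<^sup>2)))"
      using int bd by (intro integral_norm_bound_integral)
        (auto intro!: integrable_continuous_real continuous_intros sub v1 v2)
    moreover have "integral {0..r} (\<lambda>t. D * (K * t * exp (K * t\<^sup>2))) \<le> D / 2 * exp (K * r\<^sup>2)"
      using integral_unique[OF int] D(2) by (simp add: right_diff_distrib)
    ultimately show ?thesis by simp
  qed
  then show ?thesis using K by (intro exI[of _ K] conjI allI impI) auto
qed

text \<open>The weight constant \<open>K\<close> depends on \<open>R\<close>, so convergence is
  proved on each \<open>[0, R]\<close> separately. The iterates do not depend on \<open>R\<close>,
  hence the limits fit together on the half-line.\<close>

lemma picard_fixed_point:
  obtains v \<rho> where "continuous_on {0..} v" "\<And>r. 0 \<le> r \<Longrightarrow> v r = picard v r" "0 < \<rho>"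
    "\<And>s. s \<in> {0..\<rho>} \<Longrightarrow> 1 / 2 \<le> v s"
proof -
  \<comment> \<open>For \<open>s \<le> \<rho>\<close> the bound 1 gives \<open>s^2 \<le> s\<close>
    and the bound \<open>1 / slope\<close> then gives \<open>slope * s^2 \<le> 1\<close>, so the
    quadratic lower bound is at least \<open>1 / 2\<close>.\<close>
  define \<rho> where "\<rho> = min 1 (1 / slope)"
  have \<rho>: "0 < \<rho>" using slope_pos by (simp add: \<rho>_def)
  have half: "1 / 2 \<le> picard v s" if "continuous_on {0..} v" "s \<in> {0..\<rho>}" for v s
  proof -
    have "s\<^sup>2 \<le> s" using that by (auto simp: \<rho>_def power2_eq_square mult_left_le)
    then have "s\<^sup>2 \<le> 1 / slope" using that by (auto simp: \<rho>_def)
    then have "slope * s\<^sup>2 \<le> 1" using slope_pos by (simp add: field_simps)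
    then show ?thesis using picard_bounds(2)[OF that(1), of s] that by auto
  qed
  define w where "w m = (picard ^^ m) (\<lambda>_. 1)" for m
  have w0: "w 0 = (\<lambda>_. 1)" and wS: "w (Suc m) = picard (w m)" for m by (simp_all add: w_def)
  have cw: "continuous_on {0..} (w m)" for m
    by (induction m) (auto simp: w0 wS intro: continuous_on_picard)
  have hw: "1 / 2 \<le> w m s" if "s \<in> {0..\<rho>}" for m s
    using half[OF cw that] by (cases m) (auto simp: w0 wS)
  \<comment> \<open>A telescoping series names the limit without reference to \<open>R\<close> and
    prepares the Weierstrass test.\<close>
  define v where "v r = 1 + (\<Sum>m. w (Suc m) r - w m r)" for r
  have lim: "uniform_limit {0..R} w v sequentially" if R: "\<rho> \<le> R" for R
  proof -
    obtain K where K: "0 < K"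
      "\<forall>v1 v2 D r. continuous_on {0..} v1 \<longrightarrow> continuous_on {0..} v2 \<longrightarrow>
       (\<forall>s\<in>{0..\<rho>}. 1 / 2 \<le> v1 s) \<longrightarrow> (\<forall>s\<in>{0..\<rho>}. 1 / 2 \<le> v2 s) \<longrightarrow>
       (\<forall>s\<in>{0..R}. \<bar>v1 s - v2 s\<bar> \<le> D * exp (K * s\<^sup>2)) \<longrightarrow> 0 \<le> D \<longrightarrow> r \<in> {0..R} \<longrightarrow>
       \<bar>picard v1 r - picard v2 r\<bar> \<le> D / 2 * exp (K * r\<^sup>2)"
      using picard_contraction[OF \<rho> R] by blast
    \<comment> \<open>The first iterate differs from the constant 1 by at most
      \<open>slope * r^2 / 2\<close>, which \<open>D\<close> dominates on
      \<open>[0, R]\<close>.\<close>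
    define D where "D = slope * R\<^sup>2"
    have D: "0 \<le> D" using slope_pos by (simp add: D_def)
    have step: "\<bar>w (Suc m) r - w m r\<bar> \<le> D * (1 / 2) ^ m * exp (K * r\<^sup>2)" if "r \<in> {0..R}" for m r
      using that
    proof (induction m arbitrary: r)
      case 0
      have "slope * r\<^sup>2 \<le> D" using 0 slope_pos unfolding D_def by (intro mult_left_mono power_mono) auto
      moreover have "0 \<le> slope * r\<^sup>2" using slope_pos by simp
      ultimately have "\<bar>w (Suc 0) r - w 0 r\<bar> \<le> D"
        using picard_bounds[of "w 0" r] cw[of 0] 0 D by (simp add: wS w0)
      also have "\<dots> \<le> D * exp (K * r\<^sup>2)" using D K by (simp add: mult_le_cancel_left1)
      finally show ?case by simp
    next
      case (Suc m)
      have "\<bar>picard (w (Suc m)) r - picard (w m) r\<bar> \<le> (D * (1 / 2) ^ m) / 2 * exp (K * r\<^sup>2)"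
        using Suc D hw by (intro K(2)[rule_format] cw) auto
      then show ?case by (simp add: wS)
    qed
    have "uniform_limit {0..R} (\<lambda>m r. \<Sum>i<m. w (Suc i) r - w i r) (\<lambda>r. \<Sum>i. w (Suc i) r - w i r) sequentially"
    proof (rule Weierstrass_m_test)
      fix m r assume r: "r \<in> {0..R}"
      have "exp (K * r\<^sup>2) \<le> exp (K * R\<^sup>2)" using r K by (auto intro!: mult_left_mono power_mono)
      then have "D * (1 / 2) ^ m * exp (K * r\<^sup>2) \<le> D * (1 / 2) ^ m * exp (K * R\<^sup>2)"
        using D by (intro mult_left_mono) auto
      then show "norm (w (Suc m) r - w m r) \<le> D * exp (K * R\<^sup>2) * (1 / 2) ^ m"
        using step[OF r, of m] by (simp add: mult.commute mult.left_commute)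
    next
      show "summable (\<lambda>m. D * exp (K * R\<^sup>2) * (1 / 2) ^ m)" by (intro summable_mult summable_geometric) auto
    qed
    then have "uniform_limit {0..R} (\<lambda>m r. 1 + (\<Sum>i<m. w (Suc i) r - w i r)) v sequentially"
      unfolding v_def by (rule uniform_limit_add[OF uniform_limit_const])
    moreover have "1 + (\<Sum>i<m. w (Suc i) r - w i r) = w m r" for m r
      by (induction m) (simp_all add: w0)
    ultimately show ?thesis by simp
  qed
  have ptw: "(\<lambda>m. w m r) \<longlonglongrightarrow> v r" if "0 \<le> r" for r
    by (rule tendsto_uniform_limitI[OF lim[of "max \<rho> r"]]) (use that in auto)
  have cv: "continuous_on {0..} v"
  proof (rule continuous_on_atLeast_if_Icc)
    fix b :: real assume "0 < b"
    have "continuous_on {0..max \<rho> b} v"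
      by (rule uniform_limit_theorem[OF _ lim]) (auto intro!: always_eventually continuous_on_subset[OF cw])
    then show "continuous_on {0..b} v" by (rule continuous_on_subset) auto
  qed
  have hv: "1 / 2 \<le> v s" if "s \<in> {0..\<rho>}" for s
    by (rule LIMSEQ_le_const[OF ptw]) (use that hw in auto)
  have fix_v: "v r = picard v r" if r: "0 \<le> r" for r
  proof -
    define R where "R = max \<rho> r"
    have R: "\<rho> \<le> R" "r \<in> {0..R}" using r by (auto simp: R_def)
    obtain K where K: "0 < K"
      "\<forall>v1 v2 D r. continuous_on {0..} v1 \<longrightarrow> continuous_on {0..} v2 \<longrightarrow>
       (\<forall>s\<in>{0..\<rho>}. 1 / 2 \<le> v1 s) \<longrightarrow> (\<forall>s\<in>{0..\<rho>}. 1 / 2 \<le> v2 s) \<longrightarrow>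
       (\<forall>s\<in>{0..R}. \<bar>v1 s - v2 s\<bar> \<le> D * exp (K * s\<^sup>2)) \<longrightarrow> 0 \<le> D \<longrightarrow> r \<in> {0..R} \<longrightarrow>
       \<bar>picard v1 r - picard v2 r\<bar> \<le> D / 2 * exp (K * r\<^sup>2)"
      using picard_contraction[OF \<rho> R(1)] by blast
    \<comment> \<open>The contraction estimate also gives continuity of \<open>picard\<close> along
      the iterates: a uniform error \<open>d\<close> satisfies the weighted bound because the weight
      is at least 1.\<close>
    have "(\<lambda>m. w (Suc m) r) \<longlonglongrightarrow> picard v r"
    proof (rule LIMSEQ_I)
      fix e :: real assume e: "0 < e"
      define d where "d = e / exp (K * r\<^sup>2)"
      have d: "0 < d" using e by (simp add: d_def)
      obtain N where N: "\<And>m s. m \<ge> N \<Longrightarrow> s \<in> {0..R} \<Longrightarrow> dist (w m s) (v s) < d"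
        using uniform_limitD[OF lim[OF R(1)] d] unfolding eventually_sequentially by blast
      have "norm (w (Suc m) r - picard v r) < e" if m: "m \<ge> N" for m
      proof -
        have "\<bar>picard (w m) r - picard v r\<bar> \<le> d / 2 * exp (K * r\<^sup>2)"
        proof (intro K(2)[rule_format] cw cv)
          fix s assume "s \<in> {0..R}"
          then have "\<bar>w m s - v s\<bar> \<le> d" using N[OF m] by (simp add: dist_real_def less_imp_le)
          also have "d \<le> d * exp (K * s\<^sup>2)" using d K by (simp add: mult_le_cancel_left1)
          finally show "\<bar>w m s - v s\<bar> \<le> d * exp (K * s\<^sup>2)" .
        qed (use d R hw hv in auto)
        also have "\<dots> = e / 2" by (simp add: d_def)
        finally show ?thesis using e by (simp add: wS)
      qed
      then show "\<exists>N. \<forall>m\<ge>N. norm (w (Suc m) r - picard v r) < e" by blast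
    qed
    moreover have "(\<lambda>m. w (Suc m) r) \<longlonglongrightarrow> v r" using ptw[OF r] by (rule LIMSEQ_Suc)
    ultimately show ?thesis using LIMSEQ_unique by blast
  qed
  show ?thesis by (rule that[OF cv fix_v \<rho> hv])
qed

end

section \<open>Lyapunov function and decay\<close>

text \<open>Young's inequality with exponents \<open>k + 1\<close> and \<open>(k + 1) / k\<close>.
  In the induction step, \<open>b\<close> times the hypothesis falls short of the claim exactly by
  the nonnegative product \<open>(a - b) * (a ^ (k + 1) - b ^ (k + 1))\<close>.\<close>

lemma young_power:
  fixes a b :: real
  assumes "0 \<le> a" "0 \<le> b"
  shows "(real k + 1) * a * b ^ k \<le> a ^ (k + 1) + real k * b ^ (k + 1)"
proof (induction k)
  case (Suc k)
  have "0 \<le> (a - b) * (a ^ (k + 1) - b ^ (k + 1))"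
  proof (cases "a \<le> b")
    case True
    then show ?thesis using assms by (intro mult_nonpos_nonpos) (auto intro!: power_mono simp del: power_Suc)
  next
    case False
    then show ?thesis using assms by (intro mult_nonneg_nonneg) (auto intro!: power_mono simp del: power_Suc)
  qed
  moreover have "b * ((real k + 1) * a * b ^ k) \<le> b * (a ^ (k + 1) + real k * b ^ (k + 1))"
    using Suc assms by (intro mult_left_mono) auto
  ultimately show ?case by (simp add: algebra_simps)
qed simp

context radial_k_Hessian begin

definition \<gamma> :: real where "\<gamma> = 2 * real k / (q - real k)"

definition \<theta> :: real where "\<theta> = real n - 2 * real k - (real k + 1) * \<gamma>"

lemma gamma_pos: "0 < \<gamma>" using q_gt_k k_gt1 by (simp add: \<gamma>_def)

text \<open>The scaling balance: \<open>z powr q\<close> and \<open>y ^ k\<close> carry the same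
  power of \<open>r\<close>, so the system for \<open>(z, y)\<close> is autonomous.\<close>

lemma gamma_q: "\<gamma> * q = \<gamma> * real k + 2 * real k"
  using q_gt_k by (simp add: \<gamma>_def field_simps)

lemma theta_pos: "0 < \<theta>"
proof -
  have p: "real n - 2 * real k > 0" using n_gt by linarith
  then have "(real n + 2) * real k < q * (real n - 2 * real k)"
    using q_supercritical by (simp add: pos_divide_less_eq)
  \<comment> \<open>Subtract \<open>k * (n - 2k)\<close> on both sides and use
    \<open>(n + 2) * k - k * (n - 2k) = 2k * (k + 1)\<close>.\<close>
  then have "(real k + 1) * (2 * real k) < (real n - 2 * real k) * (q - real k)"
    by (simp add: algebra_simps)
  then have "(real k + 1) * \<gamma> < real n - 2 * real k"
    using q_gt_k by (simp add: \<gamma>_def pos_divide_less_eq)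
  then show ?thesis by (simp add: \<theta>_def)
qed

end

text \<open>The radius \<rho> stays attached to the profile: it yields positivity of the flux at
  every radius and positivity of \<open>v\<close> where the Lyapunov argument starts.\<close>

locale radial_profile = radial_k_Hessian +
  fixes v :: "real \<Rightarrow> real" and \<rho> :: real
  assumes v_cont: "continuous_on {0..} v" and v_fix: "\<And>r. 0 \<le> r \<Longrightarrow> v r = picard v r"
    and rho_pos: "0 < \<rho>" and v_half: "\<And>s. s \<in> {0..\<rho>} \<Longrightarrow> 1 / 2 \<le> v s"
begin

abbreviation J :: "real \<Rightarrow> real" where "J \<equiv> flux v"

text \<open>This is \<open>- v'(r) / r\<close>, extended continuously to
  \<open>r = 0\<close>.\<close>

definition G :: "real \<Rightarrow> real" where "G r = J r powr (1 / real k)"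

definition z :: "real \<Rightarrow> real" where "z r = r powr \<gamma> * v r"

definition y :: "real \<Rightarrow> real" where "y r = r powr (\<gamma> + 2) * G r"

text \<open>In the variable \<open>t = ln r\<close> the pair \<open>(z, y)\<close> solves an autonomous system with
  \<open>z' = \<gamma> z - y\<close>, and \<open>V\<close> decreases along it because \<open>\<theta> > 0\<close>.\<close>
definition V :: "real \<Rightarrow> real" where
  "V r = c / (q + 1) * z r powr (q + 1) + real k / (real k + 1) * y r ^ (k + 1)
     - \<gamma> * z r * y r ^ k - \<theta> * \<gamma> ^ k / (real k + 1) * z r ^ (k + 1)"

section \<open>Positivity and derivatives of the profile\<close>

lemma J_pos:
  assumes "0 \<le> r"
  shows "0 < J r"
proof -
  have "c / real n * (1 / 2) powr q * (\<rho> / max \<rho> r) ^ n \<le> J r"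
    by (rule flux_ge[OF v_cont v_half rho_pos]) (use assms in auto)
  moreover have "0 < c / real n * (1 / 2) powr q * (\<rho> / max \<rho> r) ^ n"
    using c_pos n_pos rho_pos by simp
  ultimately show ?thesis by linarith
qed

lemma G_pos: "0 \<le> r \<Longrightarrow> 0 < G r" using J_pos[of r] by (simp add: G_def)

lemma G_power: "0 \<le> r \<Longrightarrow> G r ^ k = J r"
  using J_pos[of r] k_gt1 by (simp add: G_def powr_power)

lemma continuous_on_G: "continuous_on {0..} G"
  unfolding G_def[abs_def] using J_pos
  by (intro continuous_on_powr' continuous_on_flux v_cont continuous_intros) force

lemma v_0: "v 0 = 1" using v_fix[of 0] by (simp add: picard_def)

lemma v_le1: "0 \<le> r \<Longrightarrow> v r \<le> 1"
  and v_ge: "0 \<le> r \<Longrightarrow> 1 - slope * r\<^sup>2 / 2 \<le> v r"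
  using picard_bounds[OF v_cont] v_fix by auto

lemma source_v: "0 \<le> r \<Longrightarrow> 0 < v r \<Longrightarrow> source (v r) = v r powr q"
  using v_le1[of r] by (simp add: source_def)

lemma v_has_derivative:
  assumes "0 < r"
  shows "(v has_real_derivative - (r * G r)) (at r)"
proof -
  have "(picard v has_real_derivative - (r * G r)) (at r)"
    unfolding G_def by (rule picard_has_derivative[OF v_cont assms])
  then show ?thesis
    by (rule has_field_derivative_transform_within_open[of _ _ _ "{0<..}"]) (use assms v_fix in auto)
qed

lemma v_antimono: "0 < a \<Longrightarrow> a \<le> b \<Longrightarrow> v b \<le> v a"
proof (rule DERIV_nonpos_imp_nonincreasing[of a b v])
  fix r assume "0 < a" "a \<le> r"
  then show "\<exists>y. (v has_real_derivative y) (at r) \<and> y \<le> 0"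
    using G_pos[of r] v_has_derivative[of r] by (intro exI[of _ "- (r * G r)"]) auto
qed

lemma G_has_derivative:
  assumes r: "0 < r"
  shows "(G has_real_derivative G r * (c * source (v r) - real n * J r) / (real k * J r) / r) (at r)"
proof -
  have J: "0 < J r" using J_pos r by simp
  have "(G has_real_derivative (1 / real k) * J r powr (1 / real k - 1)
     * ((c * source (v r) - real n * J r) / r)) (at r)"
    unfolding G_def[abs_def]
    using DERIV_fun_powr[OF flux_has_derivative[OF v_cont r] J, of "1 / real k"] by simp
  moreover have "J r powr (1 / real k - 1) = G r / J r"
    using J by (simp add: G_def powr_diff)
  ultimately show ?thesis by (simp add: field_simps)
qed

section \<open>The autonomous system and its Lyapunov function\<close>

lemma z_pos: "0 < r \<Longrightarrow> 0 < v r \<Longrightarrow> 0 < z r" by (simp add: z_def)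

lemma y_pos: "0 < r \<Longrightarrow> 0 < y r" using G_pos[of r] by (simp add: y_def)

lemma y_power:
  assumes "0 < r"
  shows "y r ^ k = r powr (\<gamma> * real k + 2 * real k) * J r"
proof -
  have "(r powr (\<gamma> + 2)) ^ k = r powr (\<gamma> * real k + 2 * real k)"
    using assms by (simp add: powr_power algebra_simps)
  then show ?thesis using assms by (simp add: y_def power_mult_distrib G_power)
qed

lemma z_powr_q:
  assumes "0 < r" "0 < v r"
  shows "z r powr q = r powr (\<gamma> * real k + 2 * real k) * v r powr q"
  using assms by (simp add: z_def powr_mult powr_powr gamma_q)

lemma z_has_derivative:
  assumes r: "0 < r"
  shows "(z has_real_derivative (\<gamma> * z r - y r) / r) (at r)"
proof -
  have "(z has_real_derivative \<gamma> * r powr (\<gamma> - 1) * v r + r powr \<gamma> * (- (r * G r))) (at r)"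
    unfolding z_def[abs_def] using r
    by (auto intro!: derivative_eq_intros v_has_derivative)
  moreover have "r powr (\<gamma> - 1) = r powr \<gamma> / r" "r powr (\<gamma> + 2) = r powr \<gamma> * r * r"
    using r by (simp_all add: powr_diff powr_add power2_eq_square)
  ultimately show ?thesis using r by (simp add: z_def y_def field_simps)
qed

text \<open>The second conclusion gives \<open>r\<close> times the derivative of
  \<open>y ^ k\<close>, the form that enters \<open>V\<close>. The coefficient comes from
  \<open>n - k * (\<gamma> + 2) = \<theta> + \<gamma>\<close>.\<close>

lemma y_has_derivative:
  assumes r: "0 < r" and v: "0 < v r"
  obtains y' where "(y has_real_derivative y') (at r)"
    "real k * y r ^ (k - 1) * y' * r = c * z r powr q - (\<theta> + \<gamma>) * y r ^ k"
proof -
  have J: "0 < J r" using J_pos r by simp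
  define y' where "y' = ((\<gamma> + 2) * y r + y r * (c * v r powr q - real n * J r) / (real k * J r)) / r"
  have "(y has_real_derivative (\<gamma> + 2) * r powr (\<gamma> + 2 - 1) * G r
     + r powr (\<gamma> + 2) * (G r * (c * source (v r) - real n * J r) / (real k * J r) / r)) (at r)"
    unfolding y_def[abs_def] using r
    by (auto intro!: derivative_eq_intros G_has_derivative)
  moreover have "r powr (\<gamma> + 2 - 1) = r powr (\<gamma> + 2) / r"
    using r by (subst powr_diff) simp
  ultimately have "(y has_real_derivative y') (at r)"
    using r v by (simp add: y'_def y_def source_v add_divide_distrib mult.assoc)
  moreover have "real k * y r ^ (k - 1) * y' * r = c * z r powr q - (\<theta> + \<gamma>) * y r ^ k"
  proof -
    have yk: "y r ^ (k - 1) * y r = y r ^ k" using k_gt1 by (intro power_minus_mult) simp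
    have "real k * y r ^ (k - 1) * y' * r
      = (y r ^ (k - 1) * y r) * (real k * (\<gamma> + 2) + (c * v r powr q - real n * J r) / J r)"
      using r k_gt1 J by (simp add: y'_def field_simps)
    also have "\<dots> = y r ^ k * (real k * (\<gamma> + 2) - real n) + c * v r powr q * (y r ^ k / J r)"
      unfolding yk using J by (simp add: field_simps)
    also have "y r ^ k / J r = r powr (\<gamma> * real k + 2 * real k)"
      using J r by (simp add: y_power)
    also have "c * v r powr q * r powr (\<gamma> * real k + 2 * real k) = c * z r powr q"
      using r v by (simp add: z_powr_q)
    finally show ?thesis by (simp add: \<theta>_def algebra_simps)
  qed
  ultimately show ?thesis by (rule that)
qed

text \<open>All terms with \<open>z powr q\<close> cancel. The mixed terms leave
  \<open>\<theta> * y ^ k * (\<gamma> * z - y)\<close>, and the last summand of \<open>V\<close>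
  supplies the \<open>(\<gamma> * z) ^ k\<close> that completes a product of definite sign.\<close>

lemma V_has_derivative:
  assumes r: "0 < r" and v: "0 < v r"
  shows "(V has_real_derivative \<theta> * (y r ^ k - (\<gamma> * z r) ^ k) * (\<gamma> * z r - y r) / r) (at r)"
proof -
  obtain y' where dy: "(y has_real_derivative y') (at r)"
    and W: "real k * y r ^ (k - 1) * y' * r = c * z r powr q - (\<theta> + \<gamma>) * y r ^ k"
    using y_has_derivative[OF r v] by blast
  define z' where "z' = (\<gamma> * z r - y r) / r"
  have dz: "(z has_real_derivative z') (at r)" unfolding z'_def by (rule z_has_derivative[OF r])
  have q1: "q + 1 \<noteq> 0" using q_gt1 by simp
  have dzq: "((\<lambda>r. z r powr (q + 1)) has_real_derivative (q + 1) * z r powr q * z') (at r)"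
    using DERIV_fun_powr[OF dz z_pos[OF r v], of "q + 1"] by simp
  have dyk: "((\<lambda>r. y r ^ k) has_real_derivative real k * y r ^ (k - 1) * y') (at r)"
    using DERIV_power[OF dy, of k] by (simp add: mult_ac)
  have dyk1: "((\<lambda>r. y r ^ (k + 1)) has_real_derivative (real k + 1) * y r ^ k * y') (at r)"
    using DERIV_power[OF dy, of "k + 1"] by (simp add: algebra_simps)
  have dzk1: "((\<lambda>r. z r ^ (k + 1)) has_real_derivative (real k + 1) * z r ^ k * z') (at r)"
    using DERIV_power[OF dz, of "k + 1"] by (simp add: algebra_simps)
  have "(V has_real_derivative c / (q + 1) * ((q + 1) * z r powr q * z')
      + real k / (real k + 1) * ((real k + 1) * y r ^ k * y')
      - (\<gamma> * z' * y r ^ k + real k * y r ^ (k - 1) * y' * (\<gamma> * z r))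
      - \<theta> * \<gamma> ^ k / (real k + 1) * ((real k + 1) * z r ^ k * z')) (at r)"
    unfolding V_def[abs_def]
    by (intro DERIV_diff DERIV_add DERIV_cmult DERIV_mult dzq dyk dyk1 dzk1 dz)
  also have "c / (q + 1) * ((q + 1) * z r powr q * z') = c * z r powr q * z'" using q1 by simp
  also have "real k / (real k + 1) * ((real k + 1) * y r ^ k * y') = y r * (real k * y r ^ (k - 1) * y')"
  proof -
    have "y r ^ k = y r ^ (k - 1) * y r" using k_gt1 by (intro power_minus_mult[symmetric]) simp
    then show ?thesis by (simp add: add_eq_0_iff)
  qed
  also have "\<theta> * \<gamma> ^ k / (real k + 1) * ((real k + 1) * z r ^ k * z') = \<theta> * (\<gamma> * z r) ^ k * z'"
    by (simp add: power_mult_distrib add_eq_0_iff)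
  also have "real k * y r ^ (k - 1) * y' = (c * z r powr q - (\<theta> + \<gamma>) * y r ^ k) / r"
    using W r by (simp add: field_simps)
  also have "c * z r powr q * z' + y r * ((c * z r powr q - (\<theta> + \<gamma>) * y r ^ k) / r)
      - (\<gamma> * z' * y r ^ k + (c * z r powr q - (\<theta> + \<gamma>) * y r ^ k) / r * (\<gamma> * z r))
      - \<theta> * (\<gamma> * z r) ^ k * z'
    = (c * z r powr q * (\<gamma> * z r - y r) + y r * (c * z r powr q - (\<theta> + \<gamma>) * y r ^ k)
      - (\<gamma> * (\<gamma> * z r - y r) * y r ^ k + (c * z r powr q - (\<theta> + \<gamma>) * y r ^ k) * (\<gamma> * z r))
      - \<theta> * (\<gamma> * z r) ^ k * (\<gamma> * z r - y r)) / r"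
    by (simp add: z'_def add_divide_distrib diff_divide_distrib algebra_simps del: power_mult_distrib)
  also have "\<dots> = \<theta> * (y r ^ k - (\<gamma> * z r) ^ k) * (\<gamma> * z r - y r) / r"
    by (rule arg_cong[where f = "\<lambda>x. x / r"]) (simp add: algebra_simps del: power_mult_distrib)
  finally show ?thesis .
qed

text \<open>The k-th power is increasing, so the two factors of the derivative have opposite signs.
  Positivity of \<open>v\<close> is what identifies the truncated source with
  \<open>v powr q\<close>.\<close>

lemma V_antimono:
  assumes "0 < a" "a \<le> b" and pos: "\<And>r. a \<le> r \<Longrightarrow> r \<le> b \<Longrightarrow> 0 < v r"
  shows "V b \<le> V a"
proof (rule DERIV_nonpos_imp_nonincreasing[OF assms(2)])
  fix r assume r: "a \<le> r" "r \<le> b"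
  have r0: "0 < r" and vr: "0 < v r" using r assms(1) pos by auto
  define a1 where "a1 = \<gamma> * z r"
  have a1: "0 < a1" using gamma_pos z_pos[OF r0 vr] by (simp add: a1_def)
  have yr: "0 < y r" by (rule y_pos[OF r0])
  have "(y r ^ k - a1 ^ k) * (a1 - y r) \<le> 0"
  proof (cases "a1 \<le> y r")
    case True
    then show ?thesis using a1 by (intro mult_nonneg_nonpos) (auto intro: power_mono)
  next
    case False
    then show ?thesis using yr by (intro mult_nonpos_nonneg) (auto intro: power_mono)
  qed
  then have "\<theta> * ((y r ^ k - a1 ^ k) * (a1 - y r)) / r \<le> 0"
    using theta_pos r0 by (simp add: mult_nonneg_nonpos divide_nonpos_pos)
  then show "\<exists>y. (V has_real_derivative y) (at r) \<and> y \<le> 0"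
    using V_has_derivative[OF r0 vr] unfolding a1_def[symmetric] by (auto simp: mult.assoc)
qed

text \<open>Divided by \<open>r powr (\<gamma> * (k + 1))\<close>, \<open>V\<close> becomes a
  function \<open>B\<close> continuous at 0. All summands of \<open>B\<close> but the last carry a
  power of \<open>r\<close>, so \<open>B 0 = - \<theta> * \<gamma> ^ k / (k + 1)\<close>.\<close>

lemma V_neg_near_0:
  obtains a where "0 < a" "a \<le> \<rho>" "V a < 0"
proof -
  define B where "B r = c / (q + 1) * r ^ (2 * k) * v r powr (q + 1)
     + real k / (real k + 1) * r ^ (2 * k + 2) * G r ^ (k + 1)
     - \<gamma> * r ^ (2 * k) * v r * G r ^ k - \<theta> * \<gamma> ^ k / (real k + 1) * v r ^ (k + 1)" for r
  have V: "V r = r powr (\<gamma> * (real k + 1)) * B r" if r: "0 < r" "0 < v r" for r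
  proof -
    define s where "s = r powr \<gamma>"
    have s: "0 < s" using r by (simp add: s_def)
    have e: "r powr (\<gamma> * (real k + 1)) = s ^ (k + 1)"
      using r by (simp add: s_def powr_power powr_add distrib_left mult.commute[of \<gamma>])
    have sq: "s powr (q + 1) = s ^ (k + 1) * r ^ (2 * k)"
    proof -
      have "\<gamma> * (q + 1) = \<gamma> * (real k + 1) + real (2 * k)" using gamma_q by (simp add: algebra_simps)
      then have "s powr (q + 1) = r powr (\<gamma> * (real k + 1)) * r powr real (2 * k)"
        unfolding s_def powr_powr by (simp only: powr_add)
      also have "r powr real (2 * k) = r ^ (2 * k)" using r by (intro powr_realpow)
      finally show ?thesis using e by simp
    qed
    have y: "y r = s * r\<^sup>2 * G r" using r by (simp add: y_def s_def powr_add)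
    have z: "z r = s * v r" by (simp add: z_def s_def)
    have zq: "z r powr (q + 1) = s ^ (k + 1) * r ^ (2 * k) * v r powr (q + 1)"
      using s r by (simp only: z powr_mult sq)
    have yk1: "y r ^ (k + 1) = s ^ (k + 1) * r ^ (2 * k + 2) * G r ^ (k + 1)"
      by (simp only: y power_mult_distrib power_mult[symmetric]) (simp add: algebra_simps power_add)
    have yk: "y r ^ k = s ^ k * r ^ (2 * k) * G r ^ k"
      by (simp only: y power_mult_distrib power_mult[symmetric])
    have zk: "z r ^ (k + 1) = s ^ (k + 1) * v r ^ (k + 1)"
      by (simp only: z power_mult_distrib)
    have zyk: "z r * y r ^ k = s ^ (k + 1) * r ^ (2 * k) * v r * G r ^ k"
      unfolding yk z by (simp add: algebra_simps)
    show ?thesis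
      unfolding V_def e B_def zq yk1 zk mult.assoc[of \<gamma> "z r"] zyk by (simp add: algebra_simps)
  qed
  have B0: "B 0 < 0" using k_gt1 theta_pos gamma_pos by (simp add: B_def v_0 zero_power)
  have v0: "(v \<longlongrightarrow> v 0) (at 0 within {0..})" and G0: "(G \<longlongrightarrow> G 0) (at 0 within {0..})"
    using v_cont continuous_on_G by (auto simp: continuous_on_def)
  have "(B \<longlongrightarrow> B 0) (at 0 within {0..})"
    unfolding B_def[abs_def] using v_0 by (intro tendsto_intros v0 G0) auto
  then have "\<forall>\<^sub>F r in at 0 within {0..}. B r < 0"
    using B0 by (rule order_tendstoD)
  then obtain d where d: "0 < d" "\<And>r. 0 \<le> r \<Longrightarrow> r \<noteq> 0 \<Longrightarrow> dist r 0 < d \<Longrightarrow> B r < 0"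
    unfolding eventually_at by auto
  define a where "a = min \<rho> (d / 2)"
  have a: "0 < a" "a \<le> \<rho>" "a < d" using d(1) rho_pos by (auto simp: a_def)
  have "0 < v a" using v_half[of a] a by auto
  moreover have "B a < 0" using d(2)[of a] a by auto
  ultimately have "V a < 0" using V[of a] a by (simp add: mult_pos_neg)
  then show ?thesis using that a by blast
qed

definition C :: real where "C = (\<theta> * \<gamma> ^ k + \<gamma> ^ (k + 1)) / (real k + 1)"

lemma C_pos: "0 < C" using theta_pos gamma_pos by (simp add: C_def add_pos_pos)

text \<open>Young's inequality for \<open>\<gamma> * z\<close> and \<open>y\<close> bounds the mixed
  term of \<open>V\<close>; its \<open>y ^ (k + 1)\<close> part cancels that of \<open>V\<close>,
  and \<open>C\<close> collects the remaining coefficients.\<close>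

lemma V_lower:
  assumes "0 < r" "0 < v r"
  shows "c / (q + 1) * z r powr (q + 1) \<le> V r + C * z r ^ (k + 1)"
proof -
  have "(real k + 1) * (\<gamma> * z r) * y r ^ k \<le> (\<gamma> * z r) ^ (k + 1) + real k * y r ^ (k + 1)"
    using gamma_pos z_pos[OF assms] y_pos[OF assms(1)] by (intro young_power) auto
  then have "\<gamma> * z r * y r ^ k \<le> ((\<gamma> * z r) ^ (k + 1) + real k * y r ^ (k + 1)) / (real k + 1)"
    by (simp add: pos_le_divide_eq mult_ac)
  also have "\<dots> = \<gamma> ^ (k + 1) / (real k + 1) * z r ^ (k + 1) + real k / (real k + 1) * y r ^ (k + 1)"
    by (simp only: add_divide_distrib power_mult_distrib) simp
  finally show ?thesis
    by (simp add: V_def C_def add_divide_distrib distrib_right)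
qed

text \<open>\<open>V\<close> is monotone only while \<open>v\<close> is positive, so the lower bound
  on \<open>z\<close> is first proved on intervals of positivity and then used to exclude a zero of
  \<open>v\<close>.\<close>

lemma v_pos_and_decay:
  obtains a z1 z2 where "0 < a" "0 < z1" "0 < z2" "\<And>r. 0 \<le> r \<Longrightarrow> 0 < v r"
    "\<And>r. a \<le> r \<Longrightarrow> z1 \<le> z r \<and> z r \<le> z2"
proof -
  obtain a where a: "0 < a" "a \<le> \<rho>" "V a < 0" using V_neg_near_0 by blast
  \<comment> \<open>The value of \<open>z\<close> at which \<open>V a + C * z ^ (k + 1)\<close>
    vanishes; smaller positive \<open>z\<close> would contradict the lower bound for
    \<open>V\<close>.\<close>
  define z1 where "z1 = root (k + 1) (- V a / C)"
  have z1: "0 < z1" "z1 ^ (k + 1) = - V a / C"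
  proof -
    have "0 < - V a / C" using a C_pos by (intro divide_pos_pos) auto
    then show "0 < z1" "z1 ^ (k + 1) = - V a / C"
      unfolding z1_def by (simp_all only: real_root_gt_zero real_root_pow_pos zero_less_Suc Suc_eq_plus1[symmetric])
  qed
  have lower: "z1 \<le> z R" if R: "a \<le> R" and pos: "\<And>r. a \<le> r \<Longrightarrow> r \<le> R \<Longrightarrow> 0 < v r" for R
  proof -
    have R0: "0 < R" "0 < v R" using a R pos by auto
    have "0 \<le> c / (q + 1) * z R powr (q + 1)" using c_pos q_gt1 by simp
    also have "\<dots> \<le> V R + C * z R ^ (k + 1)" by (rule V_lower[OF R0])
    also have "\<dots> \<le> V a + C * z R ^ (k + 1)" using V_antimono[OF a(1) R pos] by simp
    finally have "- V a \<le> z R ^ (k + 1) * C" by (simp only: mult.commute[of C])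
    then have "z1 ^ (k + 1) \<le> z R ^ (k + 1)" unfolding z1(2) using C_pos by (simp only: pos_divide_le_eq)
    then have "z1 ^ Suc k \<le> z R ^ Suc k" by (simp only: Suc_eq_plus1)
    then show ?thesis using z_pos[OF R0] by (rule power_le_imp_le_base[OF _ less_imp_le])
  qed
  have pos_a: "0 < v r" if "0 \<le> r" "r \<le> a" for r
    using v_half[of r] that a(2) by simp
  have pos: "0 < v R" if "a \<le> R" for R
  proof (rule ccontr)
    assume neg: "\<not> 0 < v R"
    have R0: "0 < R" using that a by simp
    \<comment> \<open>A level below \<open>v a\<close> that \<open>v\<close> must cross before
      \<open>R\<close>, yet so small that \<open>z\<close> would be below \<open>z1\<close> at the
      crossing.\<close>
    define e where "e = min (v a) (z1 * R powr (- \<gamma>)) / 2"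
    have "0 < v a" "0 < z1 * R powr (- \<gamma>)" using pos_a[of a] a(1) z1(1) R0 by auto
    then have e: "0 < e" "e < v a" "e < z1 * R powr (- \<gamma>)"
      unfolding e_def by linarith+
    have cont: "continuous_on {a..R} v" by (rule continuous_on_subset[OF v_cont]) (use a(1) in simp)
    have "v R \<le> e" "e \<le> v a" using neg e by linarith+
    from IVT2'[OF this that cont] obtain s where s: "a \<le> s" "s \<le> R" "v s = e" by auto
    \<comment> \<open>As \<open>v\<close> decreases, it is at least \<open>e\<close> up to the
      crossing \<open>s\<close>, so the lower bound on \<open>z\<close> applies at
      \<open>s\<close>.\<close>
    have "0 < v r" if "a \<le> r" "r \<le> s" for r
      using v_antimono[of r s] that a(1) s(3) e(1) by linarith
    then have "z1 \<le> z s" by (rule lower[OF s(1)])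
    then have "z1 \<le> s powr \<gamma> * e" by (simp add: z_def s(3))
    also have "\<dots> \<le> R powr \<gamma> * e"
      using s(1,2) a(1) e(1) gamma_pos by (intro mult_right_mono powr_mono2) simp_all
    also have "\<dots> < R powr \<gamma> * (z1 * R powr (- \<gamma>))"
      using e(3) R0 by (intro mult_strict_left_mono) simp_all
    also have "\<dots> = z1 * (R powr \<gamma> * R powr (- \<gamma>))" by (rule mult.left_commute)
    also have "R powr \<gamma> * R powr (- \<gamma>) = 1" using R0 by (simp add: powr_add[symmetric])
    finally show False by simp
  qed
  \<comment> \<open>With \<open>V \<le> 0\<close>, the inequality for \<open>V\<close> becomes
    \<open>z powr (q - k) \<le> C * (q + 1) / c\<close>.\<close>
  define z2 where "z2 = (C * (q + 1) / c) powr (1 / (q - real k))"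
  have upper: "z R \<le> z2" if R: "a \<le> R" for R
  proof -
    have R0: "0 < R" "0 < v R" using a R pos by auto
    have zR: "0 < z R" by (rule z_pos[OF R0])
    have "c / (q + 1) * z R powr (q + 1) \<le> V R + C * z R ^ (k + 1)" by (rule V_lower[OF R0])
    also have "\<dots> \<le> C * z R ^ (k + 1)" using V_antimono[OF a(1) R] pos a(3) by fastforce
    also have "z R ^ (k + 1) = z R powr real (k + 1)" using zR by (rule powr_realpow[symmetric])
    finally have "z R powr (q + 1) \<le> C * (q + 1) / c * z R powr real (k + 1)"
      using c_pos q_gt1 by (simp add: field_simps)
    then have "z R powr (q + 1) / z R powr real (k + 1) \<le> C * (q + 1) / c"
      using zR by (simp add: pos_divide_le_eq)
    then have "z R powr (q - real k) \<le> C * (q + 1) / c"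
      using zR by (simp add: powr_diff[symmetric])
    then have "(z R powr (q - real k)) powr (1 / (q - real k)) \<le> z2"
      unfolding z2_def using q_gt_k by (intro powr_mono2) auto
    then show ?thesis using zR q_gt_k by (simp add: powr_powr)
  qed
  have "0 < z2" using C_pos q_gt1 c_pos by (simp add: z2_def)
  moreover have "0 < v r" if "0 \<le> r" for r using pos pos_a that by (cases "a \<le> r") auto
  ultimately show ?thesis using a(1) z1(1) pos lower upper by (intro that[of a z1 z2]) auto
qed

end

section \<open>The radial function on Euclidean space\<close>

lemma partial_deriv_eq:
  assumes "(f has_derivative f') (at x)"
  shows "partial_deriv i f x = f' (axis i 1)"
  using frechet_derivative_at[OF assms] by (simp add: partial_deriv_def)

lemma has_derivative_radial:
  fixes x :: "'a::real_inner"
  assumes "x \<noteq> 0" "(g has_real_derivative g') (at (norm x))"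
  shows "((\<lambda>x. g (norm x)) has_derivative (\<lambda>h. g' / norm x * (x \<bullet> h))) (at x)"
proof -
  have "(norm has_derivative (\<lambda>h. h \<bullet> sgn x)) (at x)" by (rule has_derivative_norm[OF assms(1)])
  from has_derivative_compose[OF this] assms(2)
  have "((\<lambda>x. g (norm x)) has_derivative (\<lambda>h. g' * (h \<bullet> sgn x))) (at x)"
    by (simp add: has_field_derivative_def)
  then show ?thesis
    by (rule has_derivative_eq_rhs) (simp add: sgn_div_norm inner_commute fun_eq_iff divide_inverse)
qed

context radial_profile begin

text \<open>\<open>H r\<close> is \<open>r G'(r)\<close>, which unlike \<open>G'\<close> extends continuously to \<open>0\<close>.\<close>
definition H :: "real \<Rightarrow> real" where
  "H r = G r * (c * v r powr q - real n * J r) / (real k * J r)"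

definition u :: "real^'n \<Rightarrow> real" where "u x = - v (norm x)"

context
  assumes v_pos: "\<And>r. 0 \<le> r \<Longrightarrow> 0 < v r"
begin

lemma G_has_derivative_H: "0 < r \<Longrightarrow> (G has_real_derivative H r / r) (at r)"
  using G_has_derivative[of r] source_v[of r] v_pos[of r] by (simp add: H_def)

text \<open>The flux at 0 is exactly \<open>c / n\<close> times the source, so the numerator
  vanishes. This makes the second derivatives of \<open>u\<close> continuous at the origin.\<close>

lemma H_0: "H 0 = 0"
  using n_pos source_v[of 0] v_pos[of 0] by (simp add: H_def flux_def)

lemma continuous_on_H: "continuous_on {0..} H"
proof -
  have "continuous_on {0..} (\<lambda>r. v r powr q)"
    using v_pos by (intro continuous_on_powr' v_cont continuous_intros) force
  moreover have "\<forall>r\<in>{0..}. real k * J r \<noteq> 0" using J_pos k_gt1 by force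
  ultimately show ?thesis
    unfolding H_def[abs_def]
    by (intro continuous_on_divide continuous_on_mult continuous_on_diff continuous_on_const
        continuous_on_G continuous_on_flux[OF v_cont])
qed

text \<open>The chain rule applies away from 0. At 0, where the norm is not differentiable, the
  quadratic bound on \<open>1 - v\<close> gives derivative zero.\<close>

lemma u_has_derivative:
  fixes x :: "real^'n"
  shows "(u has_derivative (\<lambda>h. G (norm x) * (x \<bullet> h))) (at x)"
proof (cases "x = 0")
  case True
  have "(u has_derivative (\<lambda>h. 0)) (at x within UNIV)"
  proof (rule has_derivativeI_sandwich[of 1 _ _ _ _ "\<lambda>h. slope / 2 * norm (h - x)"])
    show "((\<lambda>h. slope / 2 * norm (h - x)) \<longlongrightarrow> 0) (at x)"
      by (auto intro!: tendsto_eq_intros)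
    fix w :: "real^'n" assume w: "w \<noteq> x"
    have "\<bar>u w - u x\<bar> \<le> slope * (norm w)\<^sup>2 / 2"
      using v_ge[of "norm w"] v_le1[of "norm w"] by (simp add: u_def True v_0)
    then show "norm (u w - u x - 0) / norm (w - x) \<le> slope / 2 * norm (w - x)"
      using w True by (simp add: field_simps power2_eq_square)
  qed auto
  then show ?thesis using True by simp
next
  case False
  then have r: "0 < norm x" by simp
  have "((\<lambda>x. - v (norm x)) has_derivative (\<lambda>h. (norm x * G (norm x)) / norm x * (x \<bullet> h))) (at x)"
    by (rule has_derivative_radial[OF False]) (use v_has_derivative[OF r] in \<open>auto intro!: derivative_eq_intros\<close>)
  then show ?thesis using False by (simp add: u_def[abs_def])
qed

lemma partial_deriv_u: "partial_deriv j u = (\<lambda>x. G (norm x) * x $ j)"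
  by (rule ext) (simp add: partial_deriv_eq[OF u_has_derivative] inner_axis)

text \<open>At the origin the second summand vanishes and continuity of \<open>G\<close> gives the
  derivative; elsewhere this is the product rule.\<close>

lemma partial_u_has_derivative:
  fixes x :: "real^'n"
  shows "(partial_deriv j u has_derivative
     (\<lambda>h. G (norm x) * h $ j + H (norm x) / (norm x)\<^sup>2 * (x \<bullet> h) * x $ j)) (at x)"
proof (cases "x = 0")
  case True
  have "((\<lambda>x. G (norm x) * x $ j) has_derivative (\<lambda>h. G 0 * h $ j)) (at x within UNIV)"
  proof (rule has_derivativeI_sandwich[of 1 _ _ _ _ "\<lambda>w. \<bar>G (norm w) - G 0\<bar>"])
    show "bounded_linear (\<lambda>h::real^'n. G 0 * h $ j)"
      by (intro bounded_linear_const_mult bounded_linear_vec_nth)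
    have "continuous_on UNIV (\<lambda>w::real^'n. G (norm w))"
      by (rule continuous_on_compose2[OF continuous_on_G]) (auto intro: continuous_intros)
    then have "((\<lambda>w::real^'n. G (norm w)) \<longlongrightarrow> G (norm x)) (at x)" by (auto simp: continuous_on_def)
    then show "((\<lambda>w. \<bar>G (norm w) - G 0\<bar>) \<longlongrightarrow> 0) (at x)"
      using True by (auto intro!: tendsto_eq_intros)
    fix w :: "real^'n" assume w: "w \<noteq> x"
    have "\<bar>G (norm w) * w $ j - G 0 * w $ j\<bar> \<le> \<bar>G (norm w) - G 0\<bar> * norm w"
      using component_le_norm_cart[of w j] by (simp add: left_diff_distrib[symmetric] abs_mult mult_left_mono)
    then show "norm (G (norm w) * w $ j - G (norm x) * x $ j - G 0 * (w - x) $ j) / norm (w - x)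
        \<le> \<bar>G (norm w) - G 0\<bar>"
      using w True by (simp add: pos_divide_le_eq)
  qed auto
  then show ?thesis using True by (simp add: partial_deriv_u)
next
  case False
  then have r: "0 < norm x" by simp
  have "((\<lambda>x. G (norm x)) has_derivative (\<lambda>h. (H (norm x) / norm x) / norm x * (x \<bullet> h))) (at x)"
    by (rule has_derivative_radial[OF False G_has_derivative_H[OF r]])
  moreover have "((\<lambda>x::real^'n. x $ j) has_derivative (\<lambda>h. h $ j)) (at x)"
    by (rule bounded_linear_imp_has_derivative[OF bounded_linear_vec_nth])
  ultimately have "((\<lambda>x. G (norm x) * x $ j) has_derivative
      (\<lambda>h. G (norm x) * h $ j + (H (norm x) / norm x) / norm x * (x \<bullet> h) * x $ j)) (at x)"
    by (rule has_derivative_mult)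
  then show ?thesis by (simp add: partial_deriv_u power2_eq_square)
qed

lemma second_partial_deriv_u:
  fixes x :: "real^'n"
  shows "partial_deriv i (partial_deriv j u) x
     = (if i = j then G (norm x) else 0) + H (norm x) * (x $ i / norm x) * (x $ j / norm x)"
proof -
  have "(axis i 1 :: real^'n) $ j = (if i = j then 1 else 0)" by (simp add: axis_def)
  then show ?thesis
    by (simp add: partial_deriv_eq[OF partial_u_has_derivative] inner_axis power2_eq_square)
qed

lemma C2_u: "C2 (u :: real^'n \<Rightarrow> real)"
  unfolding C2_def
proof (intro conjI allI)
  show "u differentiable at x" for x :: "real^'n" using u_has_derivative differentiableI by blast
  show "partial_deriv i u differentiable at x" for i and x :: "real^'n"
    using partial_u_has_derivative differentiableI by blast
  fix i j :: 'n
  have cG: "continuous_on UNIV (\<lambda>w::real^'n. G (norm w))"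
    by (rule continuous_on_compose2[OF continuous_on_G]) (auto intro: continuous_intros)
  have cH: "continuous_on UNIV (\<lambda>w::real^'n. H (norm w))"
    by (rule continuous_on_compose2[OF continuous_on_H]) (auto intro: continuous_intros)
  have "isCont (\<lambda>x::real^'n. H (norm x) * (x $ i / norm x) * (x $ j / norm x)) x" for x
  proof (cases "x = 0")
    case True
    have "((\<lambda>x::real^'n. H (norm x) * (x $ i / norm x) * (x $ j / norm x)) \<longlongrightarrow> 0) (at 0)"
    \<comment> \<open>The direction cosines have no limit at 0 but are bounded by 1, while
      \<open>H\<close> tends to 0.\<close>
    proof (rule Lim_null_comparison)
      have "((\<lambda>w::real^'n. H (norm w)) \<longlongrightarrow> H (norm (0::real^'n))) (at 0)"
        using cH unfolding continuous_on_def by blast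
      then show "((\<lambda>w::real^'n. \<bar>H (norm w)\<bar>) \<longlongrightarrow> 0) (at 0)"
        using H_0 by (auto intro!: tendsto_eq_intros)
      have le1: "\<bar>w $ l / norm w\<bar> \<le> 1" for w :: "real^'n" and l
        using component_le_norm_cart[of w l] by (simp add: divide_le_eq)
      have "norm (H (norm w) * (w $ i / norm w) * (w $ j / norm w)) \<le> \<bar>H (norm w)\<bar>" for w :: "real^'n"
      proof -
        have "\<bar>H (norm w)\<bar> * (\<bar>w $ i / norm w\<bar> * \<bar>w $ j / norm w\<bar>) \<le> \<bar>H (norm w)\<bar> * 1"
          using le1 by (intro mult_left_mono mult_le_one) auto
        then show ?thesis by (simp add: abs_mult)
      qed
      then show "\<forall>\<^sub>F w in at 0. norm (H (norm w) * (w $ i / norm w) * (w $ j / norm (w::real^'n))) \<le> \<bar>H (norm w)\<bar>"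
        by (intro always_eventually allI)
    qed
    then show ?thesis using True by (simp add: isCont_def)
  next
    case False
    have "isCont (\<lambda>w::real^'n. H (norm w)) x" using cH by (auto simp: continuous_on_eq_continuous_at)
    then show ?thesis using False by (auto intro!: continuous_intros)
  qed
  moreover have "isCont (\<lambda>x::real^'n. if i = j then G (norm x) else 0) x" for x
    using cG by (cases "i = j") (auto simp: continuous_on_eq_continuous_at)
  ultimately show "continuous_on UNIV (partial_deriv i (partial_deriv j u))"
    unfolding continuous_on_eq_continuous_at[OF open_UNIV]
    by (auto simp: second_partial_deriv_u[abs_def] intro: continuous_add)
qed

text \<open>The relation between the two binomials and the formula for \<open>k * d\<close> reduce
  \<open>k\<close> times the Hessian operator to \<open>N0 * c * w\<close>; the choice of
  \<open>c\<close> turns this into \<open>k * w\<close>.\<close>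

lemma u_solution:
  assumes card: "CARD('n) = n" and c: "c = real k / real ((n - 1) choose (k - 1))"
  shows "k_Hessian_op k (hessian u (x::real^'n)) = (- u x) powr q"
proof -
  obtain e :: "real^'n" where e: "norm e = 1"
    and hess: "hessian u x = (\<chi> i j. (if i = j then G (norm x) else 0) + H (norm x) * e $ i * e $ j)"
  proof (cases "x = 0")
    case True
    \<comment> \<open>At the origin the Hessian is scalar since \<open>H 0 = 0\<close>, so any unit
      vector may serve as \<open>e\<close>.\<close>
    have "hessian u x = (\<chi> i j. (if i = j then G (norm x) else 0) + H (norm x) * axis undefined 1 $ i * axis undefined 1 $ j)"
      using H_0 by (simp add: hessian_def second_partial_deriv_u True vec_eq_iff del: norm_eq_zero)
    then show ?thesis using that[of "axis undefined 1"] by simp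
  next
    case False
    then have "norm (x /\<^sub>R norm x) = 1" by simp
    moreover have "hessian u x = (\<chi> i j. (if i = j then G (norm x) else 0)
        + H (norm x) * (x /\<^sub>R norm x) $ i * (x /\<^sub>R norm x) $ j)"
      by (simp add: hessian_def second_partial_deriv_u vec_eq_iff divide_inverse mult_ac)
    ultimately show ?thesis using that by blast
  qed
  define g d j w N0 N1 where "g = G (norm x)" and "d = H (norm x)" and "j = J (norm x)"
    and "w = v (norm x) powr q" and "N0 = real ((n - 1) choose (k - 1))" and "N1 = real ((n - 1) choose k)"
  have j: "0 < j" and gk: "g ^ k = j" using J_pos G_power by (auto simp: g_def j_def)
  have gk1: "g ^ k = g * g ^ (k - 1)" using k_gt1 by (metis One_nat_def Suc_lessD power_eq_if less_numeral_extra(3))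
  have N0: "0 < N0" using n_gt by (simp add: N0_def)
  have kn: "k > 0" "n > 0" using k_gt1 n_gt by auto
  have "k * (n choose k) = n * ((n - 1) choose (k - 1))" using kn by (intro times_binomial_minus1_eq) simp
  moreover have "n choose k = ((n - 1) choose (k - 1)) + ((n - 1) choose k)"
    using kn by (intro choose_reduce_nat)
  ultimately have N1: "real k * N1 = (real n - real k) * N0"
    unfolding N0_def N1_def by (metis (no_types, opaque_lifting) add_diff_cancel_left' left_diff_distrib of_nat_add of_nat_mult distrib_left)
  have kd: "real k * d = g * (c * w - real n * j) / j"
    using kn by (simp add: d_def H_def g_def w_def j_def)
  have "real k * (N0 * (g + d) * g ^ (k - 1) + N1 * g ^ k)
      = g ^ (k - 1) * (N0 * real k * g + N0 * (real k * d) + (real k * N1) * g)"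
    unfolding gk1 by (simp add: algebra_simps)
  also have "\<dots> = N0 * g ^ (k - 1) * (real n * g + real k * d)"
    unfolding N1 by (simp add: algebra_simps)
  also have "real n * g + real k * d = g * c * w / j"
    unfolding kd using j by (simp add: field_simps)
  also have "N0 * g ^ (k - 1) * (g * c * w / j) = N0 * c * w * ((g * g ^ (k - 1)) / j)"
    by simp
  also have "(g * g ^ (k - 1)) / j = 1" using gk gk1 j by simp
  also have "N0 * c * w * 1 = real k * w" using N0 unfolding c N0_def[symmetric] by simp
  finally have "N0 * (g + d) * g ^ (k - 1) + N1 * g ^ k = w" using kn by simp
  then show ?thesis
    unfolding hess k_Hessian_op_scalar_plus_rank_one[OF e kn(1)] card
    by (simp add: g_def d_def w_def N0_def N1_def u_def)
qed

end

end

theorem theorem4p5: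
  fixes k :: nat and q :: real
  assumes "CARD('n::finite) \<ge> 3"
    and "1 < k" and "real k < real CARD('n) / 2"
    and "q > (real CARD('n) + 2) * real k / (real CARD('n) - 2 * real k)"
  shows "\<exists>u :: real^'n \<Rightarrow> real. k_Hessian_solution k q u \<and> radial u \<and>
           has_decay_rate u (2 * real k / (q - real k))"
proof -
  define n where "n = CARD('n)"
  define c where "c = real k / real ((n - 1) choose (k - 1))"
  have "0 < real ((n - 1) choose (k - 1))" using assms by (simp add: n_def)
  then have "0 < c" using assms(2) by (simp add: c_def)
  then interpret radial_k_Hessian n k q c
    using assms by unfold_locales (auto simp: n_def)
  obtain v \<rho> where v: "continuous_on {0..} v" "\<And>r. 0 \<le> r \<Longrightarrow> v r = picard v r" "0 < \<rho>"
    "\<And>s. s \<in> {0..\<rho>} \<Longrightarrow> 1 / 2 \<le> v s"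
    using picard_fixed_point by blast
  interpret radial_profile n k q c v \<rho> by unfold_locales (use v in auto)
  obtain a z1 z2 where a: "0 < a" "0 < z1" "0 < z2" and v_pos: "\<And>r. 0 \<le> r \<Longrightarrow> 0 < v r"
    and z: "\<And>r. a \<le> r \<Longrightarrow> z1 \<le> z r \<and> z r \<le> z2"
    using v_pos_and_decay by blast
  define U :: "real^'n \<Rightarrow> real" where "U = u"
  have sol: "k_Hessian_solution k q U"
    unfolding k_Hessian_solution_def U_def
    using C2_u[OF v_pos] u_solution[OF v_pos, where 'n = 'n] v_pos by (auto simp: u_def n_def c_def)
  have "radial U" unfolding radial_def U_def by (intro exI[of _ "\<lambda>r. - v r"]) (simp add: u_def)
  moreover have "has_decay_rate U \<gamma>"
  proof -
    have "z1 * norm x powr - \<gamma> \<le> - U x \<and> - U x \<le> z2 * norm x powr - \<gamma>" if x: "a \<le> norm x" for x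
    proof -
      have "0 < norm x" using a(1) x by linarith
      then have "v (norm x) = z (norm x) * norm x powr - \<gamma>"
        by (simp add: z_def powr_minus)
      then show ?thesis using z[OF x] by (simp add: U_def u_def mult_right_mono)
    qed
    then have "\<forall>\<^sub>F x in at_infinity. z1 * norm x powr - \<gamma> \<le> - U x \<and> - U x \<le> z2 * norm x powr - \<gamma>"
      unfolding eventually_at_infinity by blast
    then show ?thesis unfolding has_decay_rate_def using gamma_pos a by blast
  qed
  ultimately show ?thesis using sol unfolding \<gamma>_def by blast
qed

end
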